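(* Let $k\ge 2$ and let $l_1,\dots,l_k>0$. The volume of the space of circle cacti glued from $k$ oriented circles of pairwise distinct colors $1,\dots,k$ and lengths $l_1,\dots,l_k$ is equal to $(l_1+\dots+l_k)^{k-2}$.
   Context: A circle constellation is a connected oriented graph with nonnegative edge lengths obtained by gluing together, at finitely many points, oriented circles of given lengths colored in colors $1,\dots,k$, such that two circles of the same color never share a point; it is naturally embedded in a compact oriented surface so that each circle bounds a disc of the complement, is oriented counterclockwise with respect to it, and at each gluing point the cyclic order of the circles agrees with the increasing order of colors. A circle cactus is a circle constellation that has no cycles other than the circles themselves (its natural embedding surface is a sphere). The volume measure on the space of circle cacti glued from given circles is: on the locus where no three circles share a point, take as local coordinates the lengths of all but one of the arcs into which each circle is cut by its gluing points, and use $|d\lambda_1\wedge\dots\wedge d\lambda_d|$; the locus where three or more circles share a point has measure $0$. *)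

theory Defs
  imports "HOL-Analysis.Analysis" "HOL-Library.Real_Mod" "Graph_Theory.Digraph_Component"
begin

text \<open>
  The circle of colour \<open>i\<close> and length \<open>l i\<close> is the interval \<open>{0..<l i}\<close> with its end points
  identified, oriented by increasing parameter. As the circles have pairwise distinct colours
  \<open>1, \<dots>, k\<close>, they are indexed by their colours. The pair \<open>(i, x)\<close> is the point with
  parameter \<open>x\<close> on circle \<open>i\<close>, and a gluing is the relation of being identified.
\<close>

type_synonym point = "nat \<times> real"
type_synonym gluing = "(point \<times> point) set"

definition circle_points :: "nat \<Rightarrow> (nat \<Rightarrow> real) \<Rightarrow> point set" where
  "circle_points k l = (SIGMA i:{1..k}. {0..<l i})"

definition is_gluing :: "nat \<Rightarrow> (nat \<Rightarrow> real) \<Rightarrow> gluing \<Rightarrow> bool" where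
  "is_gluing k l R \<longleftrightarrow> equiv (circle_points k l) R \<and> finite (R - Id) \<and>
     (\<forall>i x y. ((i, x), (i, y)) \<in> R \<longrightarrow> x = y)"

definition gluing_params :: "gluing \<Rightarrow> nat \<Rightarrow> real set" where
  "gluing_params R i = {x. \<exists>q. q \<noteq> (i, x) \<and> ((i, x), q) \<in> R}"

text \<open>
  The gluing points cut the circles into arcs, the edges of the glued graph; an arc is named by the
  point at which it begins. A circle without gluing points is given the artificial
  vertex \<open>0\<close>, so that it is still present in the graph (as an isolated loop).
\<close>

definition vertex_params :: "gluing \<Rightarrow> nat \<Rightarrow> real set" where
  "vertex_params R i = (if gluing_params R i = {} then {0} else gluing_params R i)"

text \<open>
  Length of the way from \<open>x\<close> to \<open>y\<close> along the orientation of a circle of length \<open>L\<close>;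
  for \<open>x = y\<close> this is a full turn.
\<close>

definition oriented_dist :: "real \<Rightarrow> real \<Rightarrow> real \<Rightarrow> real" where
  "oriented_dist L x y = (if x < y then y - x else y - x + L)"

definition next_param :: "(nat \<Rightarrow> real) \<Rightarrow> gluing \<Rightarrow> nat \<Rightarrow> real \<Rightarrow> real" where
  "next_param l R i x = arg_min_on (oriented_dist (l i) x) (vertex_params R i)"

definition arc_length :: "(nat \<Rightarrow> real) \<Rightarrow> gluing \<Rightarrow> nat \<Rightarrow> real \<Rightarrow> real" where
  "arc_length l R i x = oriented_dist (l i) x (next_param l R i x)"

definition glued_graph ::
    "nat \<Rightarrow> (nat \<Rightarrow> real) \<Rightarrow> gluing \<Rightarrow> (point set, point) pre_digraph" where
  "glued_graph k l R =
     \<lparr> verts = (\<lambda>p. R `` {p}) ` (SIGMA i:{1..k}. vertex_params R i),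
       arcs = (SIGMA i:{1..k}. vertex_params R i),
       tail = (\<lambda>p. R `` {p}),
       head = (\<lambda>(i, x). R `` {(i, next_param l R i x)}) \<rparr>"

text \<open>
  Simple cycles of the underlying undirected multigraph: arcs may be traversed in either
  direction; loops and pairs of parallel arcs count as cycles.
\<close>

definition undirected_cycle :: "('a, 'b) pre_digraph \<Rightarrow> 'b list \<Rightarrow> bool" where
  "undirected_cycle G es \<longleftrightarrow> es \<noteq> [] \<and> distinct es \<and> set es \<subseteq> arcs G \<and>
     (\<exists>vs. length vs = length es \<and> distinct vs \<and>
        (\<forall>n < length es.
           {tail G (es ! n), head G (es ! n)} = {vs ! n, vs ! (Suc n mod length es)}))"

text \<open>
  The embedding of a constellation into a surface is determined by the gluing and the colours, so
  it is no additional datum.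
\<close>

definition circle_constellation :: "nat \<Rightarrow> (nat \<Rightarrow> real) \<Rightarrow> gluing \<Rightarrow> bool" where
  "circle_constellation k l R \<longleftrightarrow>
     is_gluing k l R \<and> Digraph_Component.connected (glued_graph k l R)"

definition circle_cactus :: "nat \<Rightarrow> (nat \<Rightarrow> real) \<Rightarrow> gluing \<Rightarrow> bool" where
  "circle_cactus k l R \<longleftrightarrow> circle_constellation k l R \<and>
     (\<forall>es. undirected_cycle (glued_graph k l R) es \<longrightarrow>
        (\<exists>i\<in>{1..k}. set es = {i} \<times> vertex_params R i))"

text \<open>
  The circles carry no base points: gluings that differ by rotations of the circles (their
  orientation preserving isometries) give the same cactus.
\<close>

definition rotate_circles :: "(nat \<Rightarrow> real) \<Rightarrow> (nat \<Rightarrow> real) \<Rightarrow> point \<Rightarrow> point" where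
  "rotate_circles l \<theta> = (\<lambda>(i, x). (i, (x + \<theta> i) rmod l i))"

definition cactus_iso :: "nat \<Rightarrow> (nat \<Rightarrow> real) \<Rightarrow> (gluing \<times> gluing) set" where
  "cactus_iso k l = {(R, R'). circle_cactus k l R \<and> circle_cactus k l R' \<and>
     (\<exists>\<theta>. R' = map_prod (rotate_circles l \<theta>) (rotate_circles l \<theta>) ` R)}"

definition cactus_space :: "nat \<Rightarrow> (nat \<Rightarrow> real) \<Rightarrow> gluing set set" where
  "cactus_space k l = {R. circle_cactus k l R} // cactus_iso k l"

definition no_triple_points :: "gluing \<Rightarrow> bool" where
  "no_triple_points R \<longleftrightarrow> (\<forall>p. card (R `` {p}) \<le> 2)"

text \<open>
  In a cactus two circles \<open>i \<noteq> j\<close> share at most one point. On the locus without triple points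
  the arcs of circle \<open>i\<close> therefore correspond to the circles \<open>j\<close> touching it: the arc \<open>(i, j)\<close>
  begins at the common point of \<open>i\<close> and \<open>j\<close>. The combinatorial type records, as triples
  \<open>(i, j, j')\<close>, that the arc \<open>(i, j)\<close> ends at the common point of \<open>i\<close> and \<open>j'\<close>. The components
  of the locus are the sets of cacti of a given type, and the arc lengths are coordinates on them.
\<close>

definition contact_param :: "gluing \<Rightarrow> nat \<Rightarrow> nat \<Rightarrow> real" where
  "contact_param R i j = (THE x. \<exists>y. ((i, x), (j, y)) \<in> R)"

type_synonym comb_type = "(nat \<times> nat \<times> nat) set"

definition comb_type :: "(nat \<Rightarrow> real) \<Rightarrow> gluing \<Rightarrow> comb_type" where
  "comb_type l R = {(i, j, j'). i \<noteq> j \<and> i \<noteq> j' \<and>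
     (\<exists>x y y'. ((i, x), (j, y)) \<in> R \<and> ((i, next_param l R i x), (j', y')) \<in> R)}"

definition type_arcs :: "comb_type \<Rightarrow> (nat \<times> nat) set" where
  "type_arcs t = {(i, j). \<exists>j'. (i, j, j') \<in> t}"

definition generic_types :: "nat \<Rightarrow> (nat \<Rightarrow> real) \<Rightarrow> comb_type set" where
  "generic_types k l = comb_type l ` {R. circle_cactus k l R \<and> no_triple_points R}"

text \<open>
  The coordinates are the lengths of all but one arc of each circle; \<open>om t i = j\<close> says that
  on cacti of type \<open>t\<close> the arc \<open>(i, j)\<close> of circle \<open>i\<close> is the one left out.
\<close>

definition arc_omission :: "nat \<Rightarrow> (nat \<Rightarrow> real) \<Rightarrow> (comb_type \<Rightarrow> nat \<Rightarrow> nat) \<Rightarrow> bool" where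
  "arc_omission k l om \<longleftrightarrow>
     (\<forall>t\<in>generic_types k l. \<forall>i\<in>{1..k}. (i, om t i) \<in> type_arcs t)"

definition coord_arcs :: "(comb_type \<Rightarrow> nat \<Rightarrow> nat) \<Rightarrow> comb_type \<Rightarrow> (nat \<times> nat) set" where
  "coord_arcs om t = {(i, j) \<in> type_arcs t. j \<noteq> om t i}"

definition arc_coords ::
    "(nat \<Rightarrow> real) \<Rightarrow> (comb_type \<Rightarrow> nat \<Rightarrow> nat) \<Rightarrow> gluing \<Rightarrow> nat \<times> nat \<Rightarrow> real" where
  "arc_coords l om R =
     (\<lambda>(i, j)\<in>coord_arcs om (comb_type l R). arc_length l R i (contact_param R i j))"

definition coord_image ::
    "(nat \<Rightarrow> real) \<Rightarrow> (comb_type \<Rightarrow> nat \<Rightarrow> nat) \<Rightarrow> comb_type \<Rightarrow> gluing set set \<Rightarrow>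
     (nat \<times> nat \<Rightarrow> real) set" where
  "coord_image l om t A =
     arc_coords l om ` {R \<in> \<Union>A. no_triple_points R \<and> comb_type l R = t}"

definition coord_measure ::
    "(comb_type \<Rightarrow> nat \<Rightarrow> nat) \<Rightarrow> comb_type \<Rightarrow> (nat \<times> nat \<Rightarrow> real) measure" where
  "coord_measure om t = PiM (coord_arcs om t) (\<lambda>_. lborel)"

text \<open>
  Only cacti without triple points contribute, so the locus of triple points is a null set.
\<close>

definition cactus_volume ::
    "nat \<Rightarrow> (nat \<Rightarrow> real) \<Rightarrow> (comb_type \<Rightarrow> nat \<Rightarrow> nat) \<Rightarrow> gluing set measure" where
  "cactus_volume k l om = measure_of (cactus_space k l)
     {A. A \<subseteq> cactus_space k l \<and>
         (\<forall>t\<in>generic_types k l. coord_image l om t A \<in> sets (coord_measure om t))}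
     (\<lambda>A. \<Sum>t\<in>generic_types k l. emeasure (coord_measure om t) (coord_image l om t A))"

end

theory Submission
  imports Defs "HOL-Library.Transitive_Closure_Table" "HOL-Combinatorics.Multiset_Permutations"
begin

text \<open>
  A cactus without triple points is a tree on the circles (who touches whom) together with a
  cyclic order of the neighbours of each circle and, on each circle, positive arc lengths with
  sum \<open>l i\<close>; these data determine it up to rotations. For a circle with \<open>d i\<close> neighbours there are
  \<open>(d i - 1)!\<close> cyclic orders, and the arc lengths range over an open simplex of
  volume \<open>l i ^ (d i - 1) / (d i - 1)!\<close>. The factorials cancel, so the total volume is the
  sum over all trees of \<open>\<Prod>i. l i ^ (d i - 1)\<close>, which is \<open>(l 1 + \<dots> + l k) ^ (k - 2)\<close> by
  the weighted Cayley formula.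

  That the contact graph of a cactus is a tree follows by counting: with \<open>v\<close> gluing points, the
  glued graph has \<open>v\<close> vertices and \<open>2 v\<close> arcs, and deleting one arc of each of the \<open>k\<close> circles
  leaves it connected. If all cycles are circles, what remains is a spanning tree,
  so \<open>2 v - k = v - 1\<close>. Conversely, for \<open>v = k - 1\<close> what remains is a tree for every choice of
  the deleted arcs, so every cycle contains a full circle.
\<close>

section \<open>Cycles and spanning trees in multigraphs\<close>

text \<open>Two facts support the counting for generic cacti with \<open>k\<close> at least 2:
  connectedness gives every circle a gluing point, so the artificial vertex never occurs, and every
  vertex is a class of exactly two points, so there are twice as many arcs as vertices. A cycle that
  contains a full circle is equal to it, because the arcs of a circle already meet at each of their
  ends, leaving no way to continue elsewhere. The Cayley formula is proved for forests with a set of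
  roots, since removing the root of a tree leaves several roots. Trees are encoded as symmetric
  relations, which is the form in which the touching of circles appears. The volume is defined
  through coordinates, so countable additivity has to be proved: equal type and equal coordinates
  must force equality up to rotation. The omitted arc is recovered from the length of its circle,
  and whichever arc \<open>om\<close> omits, the coordinates fill a simplex of the same dimension
  and size, so the choice does not affect the volume.\<close>

lemma parent_function_exists:
  assumes "\<And>v. v \<in> V \<Longrightarrow> (v, r) \<in> E\<^sup>*"
  obtains p and d :: "'a \<Rightarrow> nat"
  where "\<And>v. v \<in> V \<Longrightarrow> v \<noteq> r \<Longrightarrow> (v, p v) \<in> E \<and> d (p v) < d v"
proof -
  \<comment> \<open>The length of a shortest walk to \<open>r\<close>. The parent of
    \<open>v\<close> is the second vertex of such a walk, which is closer to
    \<open>r\<close>.\<close>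
  define d where "d v = (LEAST n. (v, r) \<in> E ^^ n)" for v
  have "\<exists>w. (v, w) \<in> E \<and> d w < d v" if "v \<in> V" "v \<noteq> r" for v
  proof -
    have "\<exists>n. (v, r) \<in> E ^^ n"
      using assms[OF that(1)] by (simp add: rtrancl_power)
    then have "(v, r) \<in> E ^^ d v"
      unfolding d_def by (rule LeastI_ex)
    with that(2) obtain m where m: "d v = Suc m" "(v, r) \<in> E ^^ Suc m"
      by (cases "d v") auto
    then obtain w where w: "(v, w) \<in> E" "(w, r) \<in> E ^^ m"
      by (meson relpow_Suc_D2)
    have "d w \<le> m"
      unfolding d_def by (rule Least_le) (rule w(2))
    with m(1) w(1) show ?thesis by auto
  qed
  then show ?thesis using that by metis
qed

section \<open>Reachability along a chosen set of arcs, in either direction\<close>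

definition uadj :: "('a, 'b) pre_digraph \<Rightarrow> 'b set \<Rightarrow> ('a \<times> 'a) set" where
  "uadj G A = (\<Union>e\<in>A. {(tail G e, head G e), (head G e, tail G e)})"

lemma uadj_iff: "(x, y) \<in> uadj G A \<longleftrightarrow> (\<exists>e\<in>A. {tail G e, head G e} = {x, y})"
  unfolding uadj_def by (auto simp: doubleton_eq_iff)

lemma sym_uadj: "sym (uadj G A)"
  by (auto simp: sym_def uadj_def)

lemma uadj_rtrancl_sym: "(x, y) \<in> (uadj G A)\<^sup>* \<Longrightarrow> (y, x) \<in> (uadj G A)\<^sup>*"
  using sym_uadj[of G A] by (metis sym_rtrancl symD)

lemma uadj_mono: "A \<subseteq> B \<Longrightarrow> uadj G A \<subseteq> uadj G B"
  by (auto simp: uadj_def)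

text \<open>Every vertex except \<open>r\<close> selects an arc to its parent. An arc cannot be
  selected from both of its ends, because the distance to \<open>r\<close> strictly decreases
  towards the parent; hence exactly \<open>card V - 1\<close> arcs are selected, and following
  parents leads to \<open>r\<close>.\<close>

lemma spanning_subtree:
  assumes V: "finite V" "r \<in> V" and A: "\<And>e. e \<in> A \<Longrightarrow> tail G e \<in> V \<and> head G e \<in> V"
    and conn: "\<And>v. v \<in> V \<Longrightarrow> (v, r) \<in> (uadj G A)\<^sup>*"
  obtains B where "B \<subseteq> A" "finite B" "card B + 1 = card V" "\<And>v. v \<in> V \<Longrightarrow> (v, r) \<in> (uadj G B)\<^sup>*"
proof -
  obtain p and d :: "'a \<Rightarrow> nat" where pd: "\<And>v. v \<in> V \<Longrightarrow> v \<noteq> r \<Longrightarrow> (v, p v) \<in> uadj G A \<and> d (p v) < d v"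
    using parent_function_exists[OF conn] by blast
  then have "\<forall>v\<in>V - {r}. \<exists>e. e \<in> A \<and> {tail G e, head G e} = {v, p v}"
    unfolding uadj_iff by blast
  then obtain e where e: "\<And>v. v \<in> V - {r} \<Longrightarrow> e v \<in> A \<and> {tail G (e v), head G (e v)} = {v, p v}"
    by metis
  define B where "B = e ` (V - {r})"
  have "inj_on e (V - {r})"
  proof (rule inj_onI)
    fix v w assume vw: "v \<in> V - {r}" "w \<in> V - {r}" "e v = e w"
    then have "{v, p v} = {w, p w}" using e by metis
    moreover have "d (p v) < d v" "d (p w) < d w" using pd vw by auto
    ultimately show "v = w" by (auto simp: doubleton_eq_iff)
  qed
  then have "card B + 1 = card V"
    unfolding B_def using V by (simp add: card_image card_Diff_singleton) (metis Suc_pred card_gt_0_iff empty_iff)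
  moreover have "(v, r) \<in> (uadj G B)\<^sup>*" if "v \<in> V" for v
    using that
  proof (induction "d v" arbitrary: v rule: less_induct)
    case less
    show ?case
    proof (cases "v = r")
      case False
      then have step: "(v, p v) \<in> uadj G B"
        using e[of v] less.prems unfolding uadj_iff B_def by blast
      have "p v \<in> V"
        using e[of v] A False less.prems by (metis DiffI insertCI insertE singletonD)
      then have "(p v, r) \<in> (uadj G B)\<^sup>*"
        using less pd False by blast
      with step show ?thesis by (rule converse_rtrancl_into_rtrancl)
    qed simp
  qed
  ultimately show ?thesis
    using that[of B] e V unfolding B_def by auto
qed

lemma uadj_subset: "(\<And>e. e \<in> A \<Longrightarrow> tail G e \<in> V \<and> head G e \<in> V) \<Longrightarrow> uadj G A \<subseteq> V \<times> V"
  by (auto simp: uadj_def)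

text \<open>The rest of the cycle is a detour from one end of the deleted arc to the other.\<close>

lemma cycle_arc_redundant:
  assumes "undirected_cycle G es" "set es \<subseteq> A" "e \<in> set es"
  shows "(uadj G (A - {e}))\<^sup>* = (uadj G A)\<^sup>*"
proof -
  let ?C = "(uadj G (A - {e}))\<^sup>*" and ?n = "length es"
  obtain vs where vs: "length vs = ?n" "distinct vs"
      "\<And>n. n < ?n \<Longrightarrow> {tail G (es ! n), head G (es ! n)} = {vs ! n, vs ! (Suc n mod ?n)}"
    and es: "distinct es" "es \<noteq> []"
    using assms(1) unfolding undirected_cycle_def by blast
  obtain a where a: "a < ?n" "es ! a = e"
    using assms(3) by (auto simp: in_set_conv_nth)
  \<comment> \<open>The walk starts at the vertex after position \<open>a\<close> and needs
    \<open>?n - 1\<close> steps to come back to \<open>vs ! a\<close>. None of these steps uses the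
    arc at position \<open>a\<close>, which is \<open>e\<close>.\<close>
  have walk: "(vs ! (Suc a mod ?n), vs ! ((Suc a + s) mod ?n)) \<in> ?C" if "s < ?n" for s
    using that
  proof (induction s)
    case (Suc s)
    let ?m = "(Suc a + s) mod ?n"
    have m: "?m < ?n" using es(2) by simp
    have "?m \<noteq> a"
    proof
      assume "?m = a"
      then have "(a + Suc s) mod ?n = (a + 0) mod ?n" using a(1) by simp
      then have "Suc s mod ?n = 0 mod ?n"
        by (metis mod_eq_dvd_iff_nat add_diff_cancel_left' le_add1 mod_0 dvd_eq_mod_eq_0)
      with Suc.prems show False by simp
    qed
    then have "es ! ?m \<noteq> e"
      using a m es(1) by (auto simp: nth_eq_iff_index_eq)
    then have "es ! ?m \<in> A - {e}"
      using m assms(2) by auto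
    then have "(vs ! ?m, vs ! (Suc ?m mod ?n)) \<in> uadj G (A - {e})"
      unfolding uadj_iff using vs(3)[OF m] by blast
    moreover have "Suc ?m mod ?n = (Suc a + Suc s) mod ?n"
      by (simp add: mod_Suc_eq)
    ultimately show ?case
      using Suc by (metis Suc_lessD rtrancl.rtrancl_into_rtrancl)
  qed simp
  have "Suc a + (?n - 1) = a + ?n" using a(1) by simp
  then have "(Suc a + (?n - 1)) mod ?n = a"
    using a(1) by (metis mod_add_self2 mod_less)
  then have "(vs ! (Suc a mod ?n), vs ! a) \<in> ?C"
    using walk[of "?n - 1"] a(1) by simp
  then have ends: "(x, y) \<in> ?C" if "{tail G e, head G e} = {x, y}" for x y
    using vs(3)[OF a(1)] a(2) that uadj_rtrancl_sym by (fastforce simp: doubleton_eq_iff)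
  have "(x, y) \<in> ?C" if xy: "(x, y) \<in> uadj G A" for x y
  proof -
    obtain f where f: "f \<in> A" "{tail G f, head G f} = {x, y}"
      using xy unfolding uadj_iff by blast
    show ?thesis
    proof (cases "f = e")
      case False
      with f have "(x, y) \<in> uadj G (A - {e})" unfolding uadj_iff by blast
      then show ?thesis by blast
    qed (use f ends in blast)
  qed
  then have "uadj G A \<subseteq> ?C" by auto
  moreover have "uadj G (A - {e}) \<subseteq> uadj G A" by (rule uadj_mono) auto
  ultimately show ?thesis by (metis rtrancl_subset)
qed

text \<open>A walk from \<open>u\<close> to \<open>v\<close> can be shortened to a path with
  distinct vertices, which \<open>e\<close> closes up. Distinct steps of the path have different
  pairs of ends, so their arcs differ. For \<open>u = v\<close> the path is empty and the cycle is
  the loop \<open>e\<close>.\<close>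

lemma cycle_closing:
  assumes conn: "(u, v) \<in> (uadj G A)\<^sup>*" and e: "e \<notin> A" "e \<in> arcs G" "A \<subseteq> arcs G" "{tail G e, head G e} = {u, v}"
  obtains es where "undirected_cycle G es" "set es \<subseteq> insert e A"
proof -
  define r where "r x y \<longleftrightarrow> (x, y) \<in> uadj G A" for x y
  have "r\<^sup>*\<^sup>* u v"
    using conn by (simp add: r_def rtranclp_rtrancl_eq)
  then obtain xs where path: "rtrancl_path r u xs v" and dist: "distinct (u # xs)"
    by (metis rtranclp_eq_rtrancl_path rtrancl_path_distinct)
  define ws where "ws = u # xs"
  have "\<forall>n<length xs. \<exists>a. a \<in> A \<and> {tail G a, head G a} = {ws ! n, ws ! Suc n}"
    using rtrancl_path_nth[OF path] unfolding r_def uadj_iff ws_def by fastforce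
  then obtain f where f: "\<And>n. n < length xs \<Longrightarrow> f n \<in> A \<and> {tail G (f n), head G (f n)} = {ws ! n, ws ! Suc n}"
    by metis
  define es where "es = map f [0..<length xs] @ [e]"
  have "inj_on f {..<length xs}"
  proof (rule inj_onI)
    fix n m assume nm: "n \<in> {..<length xs}" "m \<in> {..<length xs}" "f n = f m"
    then have "{ws ! n, ws ! Suc n} = {ws ! m, ws ! Suc m}"
      using f by (metis lessThan_iff)
    moreover have "distinct ws" "length ws = Suc (length xs)"
      using dist by (auto simp: ws_def)
    ultimately show "n = m"
      using nm by (auto simp: doubleton_eq_iff nth_eq_iff_index_eq simp del: nth_Cons_Suc)
  qed
  then have "distinct es"
    using f e(1) by (auto simp: es_def distinct_map atLeast0LessThan)
  moreover have "ws ! length xs = v"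
    using rtrancl_path_last[OF path] path by (cases "xs = []") (auto simp: ws_def last_conv_nth nth_Cons' elim: rtrancl_path.cases)
  moreover have "ws ! 0 = u" by (simp add: ws_def)
  moreover have "length ws = length es" "distinct ws"
    using dist by (auto simp: ws_def es_def)
  ultimately have "undirected_cycle G es"
    unfolding undirected_cycle_def using f e
    by (intro conjI exI[of _ ws]) (auto simp: es_def nth_append less_Suc_eq mod_Suc)
  moreover have "set es \<subseteq> insert e A"
    using f by (auto simp: es_def)
  ultimately show ?thesis using that by blast
qed

text \<open>\<open>A\<close> is contained in its own spanning subtree: an arc outside it would close
  a cycle.\<close>

lemma acyclic_connected_card_le:
  assumes V: "finite V" "r \<in> V" and A: "A \<subseteq> arcs G" "\<And>e. e \<in> A \<Longrightarrow> tail G e \<in> V \<and> head G e \<in> V"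
    and conn: "\<And>v. v \<in> V \<Longrightarrow> (v, r) \<in> (uadj G A)\<^sup>*"
    and acyc: "\<And>es. undirected_cycle G es \<Longrightarrow> \<not> set es \<subseteq> A"
  shows "card A + 1 \<le> card V"
proof -
  obtain B where B: "B \<subseteq> A" "finite B" "card B + 1 = card V" "\<And>v. v \<in> V \<Longrightarrow> (v, r) \<in> (uadj G B)\<^sup>*"
    using spanning_subtree[OF V A(2) conn] by metis
  have "A \<subseteq> B"
  proof
    fix e assume e: "e \<in> A"
    show "e \<in> B"
    proof (rule ccontr)
      assume "e \<notin> B"
      moreover have "(tail G e, head G e) \<in> (uadj G B)\<^sup>*"
        using B(4) A(2)[OF e] by (metis uadj_rtrancl_sym rtrancl_trans)
      ultimately obtain es where "undirected_cycle G es" "set es \<subseteq> insert e B"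
        using cycle_closing[of "tail G e" "head G e" G B e] B(1) A(1) e by blast
      with acyc B(1) e show False by blast
    qed
  qed
  with B show ?thesis by (metis card_mono add_le_mono1)
qed

text \<open>Deleting an arc of the cycle preserves connectedness, and what remains still contains a
  spanning subtree.\<close>

lemma connected_with_cycle_card_ge:
  assumes V: "finite V" "r \<in> V" and A: "finite A" "\<And>e. e \<in> A \<Longrightarrow> tail G e \<in> V \<and> head G e \<in> V"
    and conn: "\<And>v. v \<in> V \<Longrightarrow> (v, r) \<in> (uadj G A)\<^sup>*"
    and cycle: "undirected_cycle G es" "set es \<subseteq> A"
  shows "card V \<le> card A"
proof -
  obtain e where e: "e \<in> set es"
    using cycle(1) unfolding undirected_cycle_def by (metis last_in_set)
  have "(v, r) \<in> (uadj G (A - {e}))\<^sup>*" if "v \<in> V" for v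
    using conn[OF that] cycle_arc_redundant[OF cycle e] by simp
  then obtain B where B: "B \<subseteq> A - {e}" "card B + 1 = card V"
    using spanning_subtree[OF V, of "A - {e}" G] A(2) by (metis DiffD1)
  have "card B \<le> card (A - {e})"
    using B(1) A(1) by (intro card_mono) auto
  moreover have "card (A - {e}) + 1 = card A"
    using e cycle(2) A(1) by (metis Suc_eq_plus1 card_Suc_Diff1 subsetD)
  ultimately show ?thesis using B(2) by linarith
qed

text \<open>Connectedness of a digraph is defined by walks in its symmetric closure that are
  confined to \<open>verts G\<close>. Since all arcs end in \<open>verts G\<close>, the confinement
  holds automatically and an ordinary reflexive transitive closure can be used.\<close>

lemma connected_iff_uadj:
  assumes "\<And>e. e \<in> arcs G \<Longrightarrow> tail G e \<in> verts G \<and> head G e \<in> verts G"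
  shows "Digraph_Component.connected G \<longleftrightarrow>
    verts G \<noteq> {} \<and> (\<forall>u\<in>verts G. \<forall>v\<in>verts G. (u, v) \<in> (uadj G (arcs G))\<^sup>*)"
proof -
  have ends: "arcs_ends (with_proj (mk_symmetric G)) = uadj G (arcs G)"
    by (auto simp: arcs_ends_conv parcs_mk_symmetric uadj_def)
  have "(u, v) \<in> rtrancl_on (verts G) (uadj G (arcs G)) \<longleftrightarrow> (u, v) \<in> (uadj G (arcs G))\<^sup>*"
    if "u \<in> verts G" for u v
  proof
    show "(u, v) \<in> (uadj G (arcs G))\<^sup>*" if "(u, v) \<in> rtrancl_on (verts G) (uadj G (arcs G))"
      using that by induction auto
    show "(u, v) \<in> rtrancl_on (verts G) (uadj G (arcs G))" if "(u, v) \<in> (uadj G (arcs G))\<^sup>*"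
      using that
    proof induction
      case (step y z)
      then have "z \<in> verts G" using uadj_subset[OF assms] by blast
      with step show ?case by (blast intro: rtrancl_on_into_rtrancl_on)
    qed (use \<open>u \<in> verts G\<close> in simp)
  qed
  then show ?thesis
    unfolding connected_def strongly_connected_def reachable_def ends by auto
qed

text \<open>A vertex of a cycle lies only on the two consecutive arcs around it. So the second arc
  of \<open>S\<close> at the front end of an arc must be the next arc of the cycle, and
  \<open>S\<close> is closed under going round. This is what identifies a cycle containing a full
  circle with that circle.\<close>

lemma cycle_arcs_minimal:
  assumes cyc: "undirected_cycle G es" and S: "S \<subseteq> set es" "S \<noteq> {}"
    and two: "\<And>e v. e \<in> S \<Longrightarrow> tail G e \<noteq> head G e \<Longrightarrow> v \<in> {tail G e, head G e} \<Longrightarrow>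
      \<exists>f\<in>S. f \<noteq> e \<and> v \<in> {tail G f, head G f}"
  shows "S = set es"
proof -
  let ?n = "length es"
  obtain vs where vs: "length vs = ?n" "distinct vs"
      "\<And>n. n < ?n \<Longrightarrow> {tail G (es ! n), head G (es ! n)} = {vs ! n, vs ! (Suc n mod ?n)}"
    and es: "distinct es" "es \<noteq> []"
    using cyc unfolding undirected_cycle_def by blast
  have md: "m mod ?n < ?n" for m using es(2) by simp
  have step: "es ! (Suc n mod ?n) \<in> S" if n: "n < ?n" "es ! n \<in> S" for n
  proof (cases "tail G (es ! n) = head G (es ! n)")
    case True
    then have "vs ! n = vs ! (Suc n mod ?n)" using vs(3)[OF n(1)] by auto
    then have "n = Suc n mod ?n" using vs(1,2) n(1) md by (metis nth_eq_iff_index_eq)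
    then show ?thesis using n(2) by simp
  next
    case False
    let ?v = "vs ! (Suc n mod ?n)"
    have "?v \<in> {tail G (es ! n), head G (es ! n)}" using vs(3)[OF n(1)] by blast
    then obtain f where f: "f \<in> S" "f \<noteq> es ! n" "?v \<in> {tail G f, head G f}"
      using two[OF n(2) False] by blast
    obtain m where m: "m < ?n" "f = es ! m" using f(1) S(1) by (metis in_set_conv_nth subsetD)
    have "?v = vs ! m \<or> ?v = vs ! (Suc m mod ?n)" using f(3) vs(3)[OF m(1)] m(2) by blast
    then have "Suc n mod ?n = m \<or> Suc n mod ?n = Suc m mod ?n"
      using vs(1,2) md m(1) by (metis nth_eq_iff_index_eq)
    \<comment> \<open>Equality would make \<open>f\<close> the arc at position \<open>n\<close>
      itself; hence \<open>m\<close> is the successor of \<open>n\<close>.\<close>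
    moreover have "Suc n mod ?n \<noteq> Suc m mod ?n"
    proof -
      have "n \<noteq> m" using f(2) m(2) by auto
      then show ?thesis using n(1) m(1) by (auto simp: mod_Suc)
    qed
    ultimately show ?thesis using f(1) m(2) by simp
  qed
  obtain a where a: "a < ?n" "es ! a \<in> S" using S by (metis all_not_in_conv in_set_conv_nth subsetD)
  have all: "es ! ((a + s) mod ?n) \<in> S" for s
  proof (induction s)
    case (Suc s)
    have "Suc ((a + s) mod ?n) mod ?n = (a + Suc s) mod ?n" by (simp add: mod_Suc_eq)
    then show ?case using step[OF md Suc] by simp
  qed (use a in simp)
  have "es ! m \<in> S" if "m < ?n" for m
  proof -
    have "(a + (m + ?n - a)) mod ?n = m" using that a(1) by simp
    then show ?thesis using all[of "m + ?n - a"] by simp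
  qed
  then show ?thesis using S(1) by (auto simp: in_set_conv_nth)
qed

section \<open>The weighted Cayley formula\<close>

text \<open>A forest with root set \<open>S\<close> is encoded by its parent function; being acyclic means that no
  nonempty set of non-roots is mapped into itself.\<close>

definition forests :: "'a set \<Rightarrow> 'a set \<Rightarrow> ('a \<Rightarrow> 'a) set" where
  "forests U S = {p \<in> U \<rightarrow>\<^sub>E S \<union> U. \<forall>W\<subseteq>U. p ` W \<subseteq> W \<longrightarrow> W = {}}"

lemma finite_forests: "finite U \<Longrightarrow> finite S \<Longrightarrow> finite (forests U S)"
  unfolding forests_def by (rule finite_subset[of _ "U \<rightarrow>\<^sub>E S \<union> U"]) (auto intro: finite_PiE)

definition join :: "'a set \<Rightarrow> ('a \<Rightarrow> 'b) \<Rightarrow> ('a \<Rightarrow> 'b) \<Rightarrow> 'a \<Rightarrow> 'b" where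
  "join W f g = (\<lambda>u. if u \<in> W then f u else g u)"

text \<open>\<open>W\<close> is the set of children of the roots, \<open>f\<close> tells to which
  root each of them is attached, and \<open>g\<close> is the forest that is left when the roots are
  removed. Acyclicity carries over because a subset of \<open>U\<close> closed under the parent
  function cannot contain a child of a root: its parent lies outside \<open>U\<close>.\<close>

lemma forests_decompose:
  assumes "S \<inter> U = {}"
  shows "bij_betw (\<lambda>(W, f, g). join W f g)
    (SIGMA W:Pow U. (W \<rightarrow>\<^sub>E S) \<times> forests (U - W) W) (forests U S)"
proof (rule bij_betw_byWitness[where f' = "\<lambda>p. ({u \<in> U. p u \<in> S}, restrict p {u \<in> U. p u \<in> S}, restrict p {u \<in> U. p u \<notin> S})"])
  let ?D = "SIGMA W:Pow U. (W \<rightarrow>\<^sub>E S) \<times> forests (U - W) W"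
  have out: "{u \<in> U. join W f g u \<in> S} = W \<and> {u \<in> U. join W f g u \<notin> S} = U - W"
    if "(W, f, g) \<in> ?D" for W f g
    using that assms unfolding forests_def join_def by (auto simp: PiE_iff)
  show "\<forall>d\<in>?D. (\<lambda>p. ({u \<in> U. p u \<in> S}, restrict p {u \<in> U. p u \<in> S}, restrict p {u \<in> U. p u \<notin> S}))
      ((\<lambda>(W, f, g). join W f g) d) = d"
  proof
    fix d assume d: "d \<in> ?D"
    obtain W f g where [simp]: "d = (W, f, g)" by (cases d)
    show "(\<lambda>p. ({u \<in> U. p u \<in> S}, restrict p {u \<in> U. p u \<in> S}, restrict p {u \<in> U. p u \<notin> S}))
      ((\<lambda>(W, f, g). join W f g) d) = d"
      using out[of W f g] d
      by (auto simp: join_def forests_def PiE_iff extensional_def restrict_def fun_eq_iff)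
  qed
  show "\<forall>p\<in>forests U S. (\<lambda>(W, f, g). join W f g)
     ({u \<in> U. p u \<in> S}, restrict p {u \<in> U. p u \<in> S}, restrict p {u \<in> U. p u \<notin> S}) = p"
    by (auto simp: forests_def PiE_iff extensional_def join_def restrict_def fun_eq_iff)
  show "(\<lambda>(W, f, g). join W f g) ` ?D \<subseteq> forests U S"
  proof (rule image_subsetI)
    fix d assume d: "d \<in> ?D"
    obtain W f g where [simp]: "d = (W, f, g)" by (cases d)
    have "join W f g \<in> U \<rightarrow>\<^sub>E S \<union> U"
      using d by (auto simp: forests_def PiE_iff extensional_def join_def)
    moreover have "X = {}" if X: "X \<subseteq> U" "join W f g ` X \<subseteq> X" for X
    proof -
      have "X \<inter> W = {}"
        using X d assms by (auto simp: join_def PiE_iff) blast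
      then have "g ` X \<subseteq> X" using X(2) by (force simp: join_def)
      moreover have "X \<subseteq> U - W" using X(1) \<open>X \<inter> W = {}\<close> by auto
      moreover have "g \<in> forests (U - W) W" using d by auto
      ultimately show ?thesis by (simp add: forests_def)
    qed
    ultimately show "(\<lambda>(W, f, g). join W f g) d \<in> forests U S"
      by (simp add: forests_def)
  qed
  show "(\<lambda>p. ({u \<in> U. p u \<in> S}, restrict p {u \<in> U. p u \<in> S}, restrict p {u \<in> U. p u \<notin> S})) ` forests U S \<subseteq> ?D"
  proof (rule image_subsetI)
    fix p assume p: "p \<in> forests U S"
    let ?W = "{u \<in> U. p u \<in> S}" and ?W' = "{u \<in> U. p u \<notin> S}"
    have W': "?W' = U - ?W" by auto
    have "X = {}" if "X \<subseteq> ?W'" "restrict p ?W' ` X \<subseteq> X" for X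
    proof -
      have "p ` X \<subseteq> X" using that by force
      then show ?thesis using p that unfolding forests_def by blast
    qed
    moreover have "restrict p ?W' \<in> ?W' \<rightarrow>\<^sub>E ?W \<union> ?W'"
      using p by (auto simp: forests_def PiE_iff)
    ultimately have "restrict p ?W' \<in> forests ?W' ?W"
      unfolding forests_def by blast
    then show "(?W, restrict p ?W, restrict p ?W') \<in> ?D"
      unfolding W' by auto
  qed
qed

text \<open>Double counting: each \<open>u\<close> lies in \<open>(card U - 1) choose w\<close> of
  the subsets.\<close>

lemma sum_subsets_of_card:
  fixes x :: "'a \<Rightarrow> real"
  assumes "finite U"
  shows "(\<Sum>W | W \<subseteq> U \<and> card W = Suc w. sum x W) = real ((card U - 1) choose w) * sum x U"
proof -
  have "(\<Sum>W | W \<subseteq> U \<and> card W = Suc w. sum x W)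
      = (\<Sum>W | W \<subseteq> U \<and> card W = Suc w. \<Sum>u\<in>U. if u \<in> W then x u else 0)"
  proof (rule sum.cong)
    fix W assume "W \<in> {W. W \<subseteq> U \<and> card W = Suc w}"
    then show "sum x W = (\<Sum>u\<in>U. if u \<in> W then x u else 0)"
      using assms by (simp add: sum.inter_restrict[symmetric] Int_absorb1)
  qed simp
  also have "\<dots> = (\<Sum>u\<in>U. \<Sum>W | W \<subseteq> U \<and> card W = Suc w. if u \<in> W then x u else 0)"
    by (rule sum.swap)
  also have "\<dots> = (\<Sum>u\<in>U. real ((card U - 1) choose w) * x u)"
  proof (rule sum.cong)
    fix u assume u: "u \<in> U"
    have bij: "bij_betw (insert u) {W. W \<subseteq> U - {u} \<and> card W = w} {W. W \<subseteq> U \<and> card W = Suc w \<and> u \<in> W}"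
    proof (rule bij_betw_byWitness[where f' = "\<lambda>W. W - {u}"])
      show "insert u ` {W. W \<subseteq> U - {u} \<and> card W = w} \<subseteq> {W. W \<subseteq> U \<and> card W = Suc w \<and> u \<in> W}"
        using u assms by (auto simp: card_insert_if finite_subset[of _ U] subset_Diff_insert
            intro!: card_insert_disjoint) 
    qed (use u assms in \<open>auto simp: card_Diff_singleton finite_subset\<close>)
    have "(\<Sum>W | W \<subseteq> U \<and> card W = Suc w. if u \<in> W then x u else 0)
        = (\<Sum>W | W \<subseteq> U \<and> card W = Suc w \<and> u \<in> W. x u)"
      using assms by (subst sum.If_cases) (auto intro!: arg_cong[where f = card] simp: conj_assoc Int_def)
    also have "\<dots> = real (card {W. W \<subseteq> U \<and> card W = Suc w \<and> u \<in> W}) * x u"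
      by simp
    also have "card {W. W \<subseteq> U \<and> card W = Suc w \<and> u \<in> W} = (card U - 1) choose w"
      using bij_betw_same_card[OF bij] n_subsets[of "U - {u}" w] assms u
      by (simp add: card_Diff_singleton)
    finally show "(\<Sum>W | W \<subseteq> U \<and> card W = Suc w. if u \<in> W then x u else 0)
       = real ((card U - 1) choose w) * x u" .
  qed simp
  finally show ?thesis by (simp add: sum_distrib_left)
qed

text \<open>Removing the roots turns a forest on \<open>U\<close> with roots \<open>S\<close> into a forest rooted at the set \<open>W\<close>
  of children of the roots; the binomial theorem sums up over \<open>W\<close>.\<close>

lemma sum_forests:
  fixes x :: "'a \<Rightarrow> real"
  assumes "finite U" "finite S" "S \<inter> U = {}" "U \<noteq> {}"
  shows "(\<Sum>p\<in>forests U S. \<Prod>u\<in>U. x (p u)) = sum x S * (sum x S + sum x U) ^ (card U - 1)"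
  using assms
proof (induction "card U" arbitrary: U S rule: less_induct)
  case less
  note fin = \<open>finite U\<close> \<open>finite S\<close>
  let ?F = "\<lambda>U S. \<Sum>p\<in>forests U S. \<Prod>u\<in>U. x (p u)"
  let ?s = "sum x S" and ?u = "sum x U"
  obtain n where n: "card U = Suc n"
    using less.prems by (metis card_0_eq not0_implies_Suc)
  have "?F U S = (\<Sum>d\<in>(SIGMA W:Pow U. (W \<rightarrow>\<^sub>E S) \<times> forests (U - W) W).
      \<Prod>u\<in>U. x ((\<lambda>(W, f, g). join W f g) d u))"
    using forests_decompose[OF less.prems(3)] by (rule sum.reindex_bij_betw[symmetric])
  also have "\<dots> = (\<Sum>W\<in>Pow U. \<Sum>(f, g)\<in>(W \<rightarrow>\<^sub>E S) \<times> forests (U - W) W. \<Prod>u\<in>U. x (join W f g u))"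
    using fin by (subst sum.Sigma) (auto simp: finite_forests finite_PiE finite_subset split_def)
  also have "\<dots> = (\<Sum>W\<in>Pow U. ?s ^ card W * ?F (U - W) W)"
  proof (rule sum.cong)
    fix W assume W: "W \<in> Pow U"
    then have finW: "finite W" using fin finite_subset by auto
    have "(\<Prod>u\<in>U. x (join W f g u)) = (\<Prod>u\<in>W. x (f u)) * (\<Prod>u\<in>U - W. x (g u))" for f g
    proof -
      have "(\<Prod>u\<in>U. x (join W f g u)) = (\<Prod>u\<in>U - W. x (join W f g u)) * (\<Prod>u\<in>W. x (join W f g u))"
        using W fin by (intro prod.subset_diff) auto
      then show ?thesis by (simp add: join_def mult.commute)
    qed
    then have "(\<Sum>(f, g)\<in>(W \<rightarrow>\<^sub>E S) \<times> forests (U - W) W. \<Prod>u\<in>U. x (join W f g u))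
       = (\<Sum>f\<in>W \<rightarrow>\<^sub>E S. \<Prod>u\<in>W. x (f u)) * ?F (U - W) W"
      by (simp add: sum_product sum.cartesian_product)
    also have "(\<Sum>f\<in>W \<rightarrow>\<^sub>E S. \<Prod>u\<in>W. x (f u)) = ?s ^ card W"
      using prod_sum_PiE[of W "\<lambda>_. S" "\<lambda>_. x"] finW fin by simp
    finally show "(\<Sum>(f, g)\<in>(W \<rightarrow>\<^sub>E S) \<times> forests (U - W) W. \<Prod>u\<in>U. x (join W f g u))
       = ?s ^ card W * ?F (U - W) W" .
  qed simp
  also have "\<dots> = (\<Sum>w\<le>Suc n. \<Sum>W | W \<in> Pow U \<and> card W = w. ?s ^ card W * ?F (U - W) W)"
    using fin n by (subst sum.group[of "Pow U" "{..Suc n}" card]) (auto simp: card_mono[of U, unfolded n])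
  also have "\<dots> = (\<Sum>W | W \<in> Pow U \<and> card W = 0. ?s ^ card W * ?F (U - W) W)
      + (\<Sum>w\<le>n. \<Sum>W | W \<in> Pow U \<and> card W = Suc w. ?s ^ card W * ?F (U - W) W)"
    by (rule sum.atMost_Suc_shift)
  \<comment> \<open>A nonempty forest needs at least one child of a root, so the empty
    \<open>W\<close> contributes nothing. This is why the binomial sum below starts at subsets of
    size \<open>Suc w\<close>.\<close>
  also have "(\<Sum>W | W \<in> Pow U \<and> card W = 0. ?s ^ card W * ?F (U - W) W) = 0"
  proof (rule sum.neutral, rule ballI)
    fix W assume "W \<in> {W. W \<in> Pow U \<and> card W = 0}"
    then have "W = {}" using fin by (auto dest: finite_subset)
    moreover have "forests U {} = {}"
      using \<open>U \<noteq> {}\<close> by (auto simp: forests_def PiE_iff)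
    ultimately show "?s ^ card W * ?F (U - W) W = 0" by simp
  qed
  also have "0 + (\<Sum>w\<le>n. \<Sum>W | W \<in> Pow U \<and> card W = Suc w. ?s ^ card W * ?F (U - W) W)
      = (\<Sum>w\<le>n. ?s * (real (n choose w) * ?s ^ w * ?u ^ (n - w)))"
    unfolding add_0_left
  proof (rule sum.cong)
    fix w assume w: "w \<in> {..n}"
    show "(\<Sum>W | W \<in> Pow U \<and> card W = Suc w. ?s ^ card W * ?F (U - W) W)
        = ?s * (real (n choose w) * ?s ^ w * ?u ^ (n - w))"
    \<comment> \<open>For \<open>w = n\<close> all vertices are children of roots and the empty
      forest remains, which the induction hypothesis does not cover.\<close>
    proof (cases "w = n")
      case True
      then have "{W. W \<in> Pow U \<and> card W = Suc w} = {U}"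
        using fin n card_subset_eq[of U] by auto
      moreover have "forests {} U = {\<lambda>_. undefined}"
        by (auto simp: forests_def)
      ultimately show ?thesis using True n by simp
    next
      case False
      have "(\<Sum>W | W \<in> Pow U \<and> card W = Suc w. ?s ^ card W * ?F (U - W) W)
         = (\<Sum>W | W \<subseteq> U \<and> card W = Suc w. ?s ^ Suc w * ?u ^ (n - Suc w) * sum x W)"
      proof (rule sum.cong)
        fix W assume "W \<in> {W. W \<subseteq> U \<and> card W = Suc w}"
        then have W: "W \<subseteq> U" "card W = Suc w" "finite W" using fin finite_subset by auto
        have c: "card (U - W) = n - w" using W n by (simp add: card_Diff_subset)
        then have "U - W \<noteq> {}" using False w by (metis atMost_iff card.empty diff_is_0_eq le_antisym)
        then have "?F (U - W) W = sum x W * (sum x W + sum x (U - W)) ^ (card (U - W) - 1)"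
          using W fin n c by (intro less.hyps) auto
        \<comment> \<open>The power supplied by the induction hypothesis is the same for all
          \<open>W\<close> of a given size; only the factor \<open>sum x W\<close> is left to be
          summed.\<close>
        also have "sum x W + sum x (U - W) = ?u"
          using sum.subset_diff[OF W(1) fin(1), of x] by simp
        finally show "?s ^ card W * ?F (U - W) W = ?s ^ Suc w * ?u ^ (n - Suc w) * sum x W"
          using W c by simp
      qed auto
      also have "\<dots> = ?s ^ Suc w * ?u ^ (n - Suc w) * (real (n choose w) * ?u)"
        by (simp add: sum_distrib_left[symmetric] sum_subsets_of_card[OF fin(1)] n)
      also have "?u ^ (n - w) = ?u * ?u ^ (n - Suc w)"
        using False w by (metis Suc_diff_Suc atMost_iff le_neq_implies_less power_Suc)
      then have "?s ^ Suc w * ?u ^ (n - Suc w) * (real (n choose w) * ?u) = ?s * (real (n choose w) * ?s ^ w * ?u ^ (n - w))"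
        by simp
      finally show ?thesis .
    qed
  qed simp
  also have "\<dots> = ?s * (?s + ?u) ^ n"
    by (simp add: binomial_ring sum_distrib_left)
  finally show ?case using n by simp
qed

section \<open>Trees as symmetric relations, and their weights\<close>

definition edges_of :: "'a set \<Rightarrow> ('a \<Rightarrow> 'a) \<Rightarrow> ('a \<times> 'a) set" where
  "edges_of U p = (\<Union>u\<in>U. {(u, p u), (p u, u)})"

lemma edges_of_iff: "(u, v) \<in> edges_of U p \<longleftrightarrow> u \<in> U \<and> v = p u \<or> v \<in> U \<and> u = p v"
  by (auto simp: edges_of_def)

text \<open>Every tree on \<open>V\<close> is rooted at \<open>r\<close> and then stripped of its
  orientation. The parent functions allow \<open>sum_forests\<close> to be applied, while the
  relation can be compared with the contacts of circles.\<close>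

definition tree_edges :: "'a set \<Rightarrow> 'a \<Rightarrow> ('a \<times> 'a) set set" where
  "tree_edges V r = edges_of (V - {r}) ` forests (V - {r}) {r}"

context
  fixes U :: "'a set" and p :: "'a \<Rightarrow> 'a" and S :: "'a set"
  assumes p: "p \<in> forests U S"
begin

lemma forest_closed_empty: "W \<subseteq> U \<Longrightarrow> p ` W \<subseteq> W \<Longrightarrow> W = {}"
  using p by (auto simp: forests_def)

lemma forest_maps: "u \<in> U \<Longrightarrow> p u \<in> S \<union> U"
  using p by (auto simp: forests_def PiE_iff)

lemma forest_irrefl: "u \<in> U \<Longrightarrow> p u \<noteq> u"
  using forest_closed_empty[of "{u}"] by auto

lemma forest_antisym: "u \<in> U \<Longrightarrow> p u \<in> U \<Longrightarrow> p (p u) \<noteq> u"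
  using forest_closed_empty[of "{u, p u}"] by auto

lemma edges_of_subset: "edges_of U p \<subseteq> (S \<union> U) \<times> (S \<union> U)"
  using forest_maps by (auto simp: edges_of_def)

lemma card_edges_of:
  assumes "finite U"
  shows "card (edges_of U p) = 2 * card U"
proof -
  let ?A = "(\<lambda>u. (u, p u)) ` U"
  have "edges_of U p = ?A \<union> ?A\<inverse>" by (auto simp: edges_of_def)
  moreover have "?A \<inter> ?A\<inverse> = {}"
    using forest_antisym by fastforce
  moreover have "card ?A = card U" by (intro card_image inj_onI) auto
  ultimately show ?thesis
    using assms by (simp add: card_Un_disjoint card_inverse)
qed

end

text \<open>If \<open>p u \<noteq> q u\<close>, the edge from \<open>u\<close> to \<open>p u\<close>
  must come from \<open>q (p u) = u\<close>. As \<open>p (p u) \<noteq> u\<close>, the functions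
  also disagree at \<open>p u\<close>. So the set of disagreements is closed under \<open>p\<close>
  and therefore empty.\<close>

lemma edges_of_inj: "inj_on (edges_of U) (forests U S)"
proof (rule inj_onI)
  fix p q assume p: "p \<in> forests U S" and q: "q \<in> forests U S" and eq: "edges_of U p = edges_of U q"
  define W where "W = {u \<in> U. p u \<noteq> q u}"
  have "p u \<in> W" if "u \<in> W" for u
  proof -
    have u: "u \<in> U" "p u \<noteq> q u" using that by (auto simp: W_def)
    then have "(u, p u) \<in> edges_of U q" unfolding eq[symmetric] by (auto simp: edges_of_def)
    then have "p u \<in> U" "q (p u) = u" using u by (auto simp: edges_of_iff)
    then show ?thesis using forest_antisym[OF p] u by (auto simp: W_def)
  qed
  then have "W = {}" by (intro forest_closed_empty[OF p]) (auto simp: W_def)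
  then show "p = q" using p q by (intro PiE_ext[of p U "\<lambda>_. S \<union> U" q]) (auto simp: W_def forests_def)
qed

text \<open>The vertices that do not reach \<open>r\<close> form a set closed under the parent
  function, and such a set is empty.\<close>

lemma tree_connected:
  assumes "E \<in> tree_edges V r" "v \<in> V"
  shows "(v, r) \<in> E\<^sup>*"
proof -
  obtain p where p: "p \<in> forests (V - {r}) {r}" and E: "E = edges_of (V - {r}) p"
    using assms by (auto simp: tree_edges_def)
  define W where "W = {u \<in> V - {r}. (u, r) \<notin> E\<^sup>*}"
  have "p u \<in> W" if u: "u \<in> W" for u
  proof -
    have "(u, p u) \<in> E" using u by (auto simp: W_def E edges_of_def)
    then have "(p u, r) \<notin> E\<^sup>*" using u unfolding W_def by (auto intro: converse_rtrancl_into_rtrancl)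
    then show ?thesis using forest_maps[OF p] u by (auto simp: W_def)
  qed
  then have "W = {}" by (intro forest_closed_empty[OF p]) (auto simp: W_def)
  then show ?thesis using assms(2) by (auto simp: W_def)
qed

lemma tree_edges_basic:
  assumes "E \<in> tree_edges V r" "r \<in> V" "finite V"
  shows "E \<subseteq> V \<times> V" "sym E" "irrefl E" "card E = 2 * (card V - 1)"
proof -
  obtain p where p: "p \<in> forests (V - {r}) {r}" and E: "E = edges_of (V - {r}) p"
    using assms by (auto simp: tree_edges_def)
  show "E \<subseteq> V \<times> V" using edges_of_subset[OF p] assms(2) unfolding E by auto
  show "sym E" by (auto simp: E sym_def edges_of_iff)
  show "irrefl E" using forest_irrefl[OF p] by (fastforce simp: E irrefl_def edges_of_iff)
  show "card E = 2 * (card V - 1)"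
    unfolding E using card_edges_of[OF p] assms by simp
qed

text \<open>Shortest walks to \<open>r\<close> give a parent function whose edges lie in
  \<open>E\<close>. They already number \<open>2 * (card V - 1)\<close>, counted in both directions,
  so they exhaust \<open>E\<close>.\<close>

lemma tree_edgesI:
  assumes "finite V" "r \<in> V" "E \<subseteq> V \<times> V" "sym E" "irrefl E"
    and conn: "\<And>v. v \<in> V \<Longrightarrow> (v, r) \<in> E\<^sup>*" and card: "card E \<le> 2 * (card V - 1)"
  shows "E \<in> tree_edges V r"
proof -
  let ?U = "V - {r}"
  obtain p and d :: "'a \<Rightarrow> nat" where pd: "\<And>v. v \<in> V \<Longrightarrow> v \<noteq> r \<Longrightarrow> (v, p v) \<in> E \<and> d (p v) < d v"
    using parent_function_exists[OF conn] by blast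
  define q where "q = restrict p ?U"
  have q: "q \<in> forests ?U {r}"
  proof -
    have "W = {}" if W: "W \<subseteq> ?U" "q ` W \<subseteq> W" for W
    proof (rule ccontr)
      assume "W \<noteq> {}"
      then have "Min (d ` W) \<in> d ` W"
        using W(1) assms(1) by (intro Min_in) (auto dest: finite_subset)
      then obtain w where w: "w \<in> W" "d w = Min (d ` W)" by auto
      have "p w \<in> W" "d (p w) < d w" using W w pd[of w] by (auto simp: q_def image_subset_iff)
      moreover have "finite (d ` W)" using W(1) assms(1) by (auto dest: finite_subset)
      ultimately show False using w(2) by (metis Min_le image_eqI leD)
    qed
    moreover have "q \<in> ?U \<rightarrow>\<^sub>E {r} \<union> ?U"
      using pd assms(3) by (auto simp: q_def)
    ultimately show ?thesis by (auto simp: forests_def)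
  qed
  have sub: "edges_of ?U q \<subseteq> E"
    using pd assms(4) by (auto simp: edges_of_def q_def dest: symD)
  moreover have "finite E" using assms(1,3) by (auto intro: finite_subset)
  moreover have "card E \<le> card (edges_of ?U q)"
    using card_edges_of[OF q] assms(1,2) card by simp
  ultimately have "edges_of ?U q = E"
    by (metis card_seteq)
  with q show ?thesis by (auto simp: tree_edges_def)
qed

lemma tree_nbrs_nonempty:
  assumes "E \<in> tree_edges V r" "finite V" "r \<in> V" "card V \<ge> 2" "v \<in> V"
  shows "E `` {v} \<noteq> {}"
proof (cases "v = r")
  case False
  with tree_connected[OF assms(1,5)] show ?thesis by (auto elim: converse_rtranclE)
next
  case True
  obtain w where w: "w \<in> V" "w \<noteq> r"
    using assms by (metis card_le_Suc0_iff_eq not_less_eq_eq numeral_2_eq_2)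
  then have "(w, r) \<in> E\<^sup>*" using tree_connected[OF assms(1)] by blast
  then obtain u where "(u, r) \<in> E" using w(2) by (auto elim: rtranclE)
  with True tree_edges_basic(2)[OF assms(1,3,2)] show ?thesis by (auto dest: symD)
qed

text \<open>In the tree rooted at \<open>r\<close> a vertex of degree \<open>d\<close> has
  \<open>d - 1\<close> children, but the root has \<open>d\<close>. Hence the weight in
  \<open>sum_forests\<close> is the desired one times an extra factor \<open>x r\<close>. The same
  factor appears as the root sum on the right-hand side and is cancelled at the end.\<close>

theorem weighted_cayley:
  fixes x :: "'a \<Rightarrow> real"
  assumes V: "finite V" "r \<in> V" "card V \<ge> 2" and x: "x r \<noteq> 0"
  shows "(\<Sum>E\<in>tree_edges V r. \<Prod>v\<in>V. x v ^ (card (E `` {v}) - 1)) = sum x V ^ (card V - 2)"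
proof -
  let ?U = "V - {r}"
  have finU: "finite ?U" and cU: "card ?U = card V - 1" using V by auto
  have U: "?U \<noteq> {}" using V cU by (metis card.empty diff_is_0_eq not_less_eq_eq numeral_2_eq_2 One_nat_def)
  have weight: "x r * (\<Prod>v\<in>V. x v ^ (card (edges_of ?U p `` {v}) - 1)) = (\<Prod>u\<in>?U. x (p u))"
    if p: "p \<in> forests ?U {r}" for p
  proof -
    let ?E = "edges_of ?U p" and ?ch = "\<lambda>v. {u \<in> ?U. p u = v}"
    have tree: "?E \<in> tree_edges V r" using p by (auto simp: tree_edges_def)
    have "(\<Prod>u\<in>?U. x (p u)) = (\<Prod>v\<in>V. \<Prod>u\<in>?ch v. x (p u))"
      using forest_maps[OF p] V by (intro prod.group[symmetric]) auto
    also have "\<dots> = (\<Prod>v\<in>V. x v ^ card (?ch v))"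
      by (intro prod.cong) auto
    also have "\<dots> = x r ^ card (?ch r) * (\<Prod>v\<in>?U. x v ^ card (?ch v))"
      using V by (simp add: prod.remove)
    also have "card (?ch r) = Suc (card (?E `` {r}) - 1)"
    proof -
      have "?E `` {r} = ?ch r" by (auto simp: edges_of_iff)
      moreover have "finite (?ch r)" using V by auto
      ultimately show ?thesis
        using tree_nbrs_nonempty[OF tree V V(2)] by (metis Suc_diff_1 card_gt_0_iff)
    qed
    also have "(\<Prod>v\<in>?U. x v ^ card (?ch v)) = (\<Prod>v\<in>?U. x v ^ (card (?E `` {v}) - 1))"
    proof (rule prod.cong)
      fix v assume v: "v \<in> ?U"
      have "?E `` {v} = insert (p v) (?ch v)" "p v \<notin> ?ch v"
        using v forest_antisym[OF p] by (auto simp: edges_of_iff)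
      then show "x v ^ card (?ch v) = x v ^ (card (?E `` {v}) - 1)"
        using V by simp
    qed simp
    also have "x r ^ Suc (card (?E `` {r}) - 1) * (\<Prod>v\<in>?U. x v ^ (card (?E `` {v}) - 1))
       = x r * (\<Prod>v\<in>V. x v ^ (card (?E `` {v}) - 1))"
      using V by (simp add: prod.remove[of V r])
    finally show ?thesis by simp
  qed
  have "x r * (\<Sum>E\<in>tree_edges V r. \<Prod>v\<in>V. x v ^ (card (E `` {v}) - 1))
     = (\<Sum>p\<in>forests ?U {r}. x r * (\<Prod>v\<in>V. x v ^ (card (edges_of ?U p `` {v}) - 1)))"
    unfolding tree_edges_def by (simp add: sum.reindex[OF edges_of_inj] sum_distrib_left)
  also have "\<dots> = (\<Sum>p\<in>forests ?U {r}. \<Prod>u\<in>?U. x (p u))"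
    using weight by (intro sum.cong) auto
  also have "\<dots> = x r * (x r + sum x ?U) ^ (card ?U - 1)"
    using sum_forests[of ?U "{r}" x] U finU by simp
  also have "x r + sum x ?U = sum x V" using V by (simp add: sum.remove[of V r])
  finally show ?thesis using x cU by (simp add: numeral_2_eq_2)
qed

section \<open>Finite sets of points on a circle\<close>

lemma rmod_less_double:
  assumes "0 < L" "0 \<le> u" "u < 2 * L"
  shows "u rmod L = (if u < L then u else u - L)"
  by (rule rmod_unique[where n = "if u < L then 0 else 1"]) (use assms in auto)

lemma oriented_dist_rotate:
  assumes "0 < L" "x \<in> {0..<L}" "y \<in> {0..<L}"
  shows "oriented_dist L ((c + x) rmod L) ((c + y) rmod L) = oriented_dist L x y"
proof -
  define c' where "c' = c rmod L"
  have c': "0 \<le> c'" "c' < L" using assms(1) by (auto simp: c'_def rmod_nonneg rmod_less)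
  have shift: "(c + u) rmod L = (if c' + u < L then c' + u else c' + u - L)" if "u \<in> {0..<L}" for u
  proof -
    have "(c + u) rmod L = (c' + u) rmod L"
      using rmod_add[of c L u] that assms(1) by (simp add: c'_def)
    then show ?thesis using rmod_less_double[of L "c' + u"] c' that assms(1) by simp
  qed
  show ?thesis
    using assms c' by (auto simp: shift oriented_dist_def)
qed

lemma add_oriented_dist:
  assumes "0 < L" "y \<in> {0..<L}"
  shows "(x + oriented_dist L x y) rmod L = y"
  by (rule rmod_unique[where n = "if x < y then 0 else 1"]) (use assms in \<open>auto simp: oriented_dist_def\<close>)

text \<open>The set of marked points is a parameter here, so that positions on a circle can be
  studied before any gluing is built from them.\<close>

definition circle_succ :: "real \<Rightarrow> real set \<Rightarrow> real \<Rightarrow> real" where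
  "circle_succ L P x = arg_min_on (oriented_dist L x) P"

lemma arg_min_on_unique:
  fixes f :: "'a \<Rightarrow> 'b :: linorder"
  assumes "a \<in> S" "\<And>b. b \<in> S \<Longrightarrow> b \<noteq> a \<Longrightarrow> f a < f b"
  shows "arg_min_on f S = a"
  unfolding arg_min_on_def arg_min_def is_arg_min_def
  by (rule some_equality) (use assms in force)+

section \<open>Cyclic orders given by lists\<close>

definition cyclic_pairs :: "'a list \<Rightarrow> ('a \<times> 'a) set" where
  "cyclic_pairs xs = {(xs ! n, xs ! (Suc n mod length xs)) | n. n < length xs}"

lemma cyclic_pairs_nth:
  assumes "distinct xs" "n < length xs"
  shows "(xs ! n, y) \<in> cyclic_pairs xs \<longleftrightarrow> y = xs ! (Suc n mod length xs)"
  using assms by (auto simp: cyclic_pairs_def nth_eq_iff_index_eq)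

lemma Domain_cyclic_pairs: "Domain (cyclic_pairs xs) = set xs"
  by (auto simp: cyclic_pairs_def in_set_conv_nth Domain_iff)

lemma cyclic_pairs_subset: "cyclic_pairs xs \<subseteq> set xs \<times> set xs"
proof -
  have "Suc n mod length xs < length xs" if "n < length xs" for n
    using that by (metis gr_implies_not0 mod_less_divisor neq0_conv)
  then show ?thesis by (auto simp: cyclic_pairs_def)
qed

text \<open>A cyclic order determines a list only up to rotation; fixing the first entry
  \<open>b\<close> removes this ambiguity.\<close>

lemma cyclic_pairs_inj:
  assumes "distinct (b # ps)" "distinct (b # qs)" "cyclic_pairs (b # ps) = cyclic_pairs (b # qs)"
  shows "ps = qs"
proof -
  let ?xs = "b # ps" and ?ys = "b # qs"
  have "set ?xs = set ?ys" using assms(3) by (metis Domain_cyclic_pairs)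
  then have len: "length ?xs = length ?ys" using assms(1,2) by (metis distinct_card)
  have "?xs ! n = ?ys ! n" if "n < length ?xs" for n
    using that
  proof (induction n)
    case (Suc n)
    have "(?xs ! n, ?xs ! Suc n) \<in> cyclic_pairs ?xs"
      using Suc.prems by (subst cyclic_pairs_nth[OF assms(1)]) (auto simp: mod_less)
    then have "(?ys ! n, ?xs ! Suc n) \<in> cyclic_pairs ?ys"
      using Suc assms(3) by (metis Suc_lessD)
    then show ?case
      using Suc.prems cyclic_pairs_nth[OF assms(2), of n] len by (auto simp: mod_less)
  qed simp
  then have "?xs = ?ys" using len by (metis nth_equalityI)
  then show ?thesis by simp
qed

section \<open>Points on a circle, listed by their oriented distance \<open>D\<close> from a base
  point \<open>c\<close>\<close>

context
  fixes L c :: real and D z :: "'a \<Rightarrow> real" and xs :: "'a list"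
  assumes L: "0 < L" and sorted: "sorted_wrt (<) (map D xs)"
    and D: "\<forall>j\<in>set xs. D j \<in> {0..<L}" and z: "\<forall>j\<in>set xs. z j = (c + D j) rmod L"
begin

lemma sorted_positions_less_iff: "n < length xs \<Longrightarrow> m < length xs \<Longrightarrow> D (xs ! n) < D (xs ! m) \<longleftrightarrow> n < m"
  using sorted unfolding sorted_wrt_iff_nth_less
  by (metis length_map linorder_neqE_nat nth_map order_less_asym order_less_irrefl)

lemma sorted_positions_dist:
  assumes "n < length xs" "m < length xs"
  shows "oriented_dist L (z (xs ! n)) (z (xs ! m)) = (if n < m then D (xs ! m) - D (xs ! n) else D (xs ! m) - D (xs ! n) + L)"
  using assms L D by (simp add: z oriented_dist_rotate) (simp add: oriented_dist_def sorted_positions_less_iff)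

text \<open>Seen from the entry at position \<open>n\<close>, the distances increase along the list
  from position \<open>Suc n\<close> onwards, then wrap round, and end with the full turn back to
  the point itself. So the closest entry is the cyclically next one, even if the list has only one
  entry.\<close>

lemma circle_succ_nth:
  assumes "n < length xs"
  shows "circle_succ L (z ` set xs) (z (xs ! n)) = z (xs ! (Suc n mod length xs))"
  unfolding circle_succ_def
proof (rule arg_min_on_unique)
  let ?m0 = "Suc n mod length xs"
  have m0: "?m0 < length xs" using assms by (metis gr_implies_not0 mod_less_divisor neq0_conv)
  then show "z (xs ! ?m0) \<in> z ` set xs" by simp
  fix y assume y: "y \<in> z ` set xs" "y \<noteq> z (xs ! ?m0)"
  then obtain m where m: "m < length xs" "y = z (xs ! m)" by (auto simp: in_set_conv_nth)
  with y have "m \<noteq> ?m0" by auto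
  have bound: "D (xs ! a) \<ge> 0" "D (xs ! a) < L" if "a < length xs" for a using D that by auto
  have less: "a < b \<Longrightarrow> b < length xs \<Longrightarrow> D (xs ! a) < D (xs ! b)" for a b
    using sorted_positions_less_iff[of a b] by simp
  show "oriented_dist L (z (xs ! n)) (z (xs ! ?m0)) < oriented_dist L (z (xs ! n)) y"
  proof (cases "Suc n < length xs")
    case True
    then show ?thesis
      using \<open>m \<noteq> ?m0\<close> m m0 assms bound[of m] bound[of n] bound[of "Suc n"] less[of "Suc n" m] less[of n "Suc n"]
      by (simp add: sorted_positions_dist)
  next
    case False
    with assms have "?m0 = 0" by (metis Suc_lessI mod_self)
    moreover have "m \<le> n" using False m(1) by simp
    ultimately show ?thesis
      using \<open>m \<noteq> ?m0\<close> m m0 assms bound[of m] bound[of n] less[of 0 m]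
      by (simp add: sorted_positions_dist)
  qed
qed

text \<open>Coinciding points have oriented distance \<open>L\<close>, the full turn, whereas
  different entries of the list are strictly closer in at least one direction by the bounds on
  \<open>D\<close>.\<close>

lemma sorted_positions_inj: "inj_on z (set xs)"
proof (rule inj_onI)
  fix i j assume "i \<in> set xs" "j \<in> set xs" "z i = z j"
  moreover then obtain n m where nm: "n < length xs" "m < length xs" "i = xs ! n" "j = xs ! m"
    by (auto simp: in_set_conv_nth)
  ultimately have "oriented_dist L (z (xs ! n)) (z (xs ! m)) = L" by (simp add: oriented_dist_def)
  then show "i = j"
    using nm L D[rule_format, of i] D[rule_format, of j] sorted_positions_dist[of n m] sorted_positions_less_iff[of n m] sorted_positions_less_iff[of m n]
    by (cases n m rule: linorder_cases) (auto split: if_splits)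
qed

lemma circle_succ_iff_cyclic_pairs:
  "(j, j') \<in> cyclic_pairs xs \<longleftrightarrow> j \<in> set xs \<and> j' \<in> set xs \<and> z j' = circle_succ L (z ` set xs) (z j)"
proof (cases "j \<in> set xs")
  case True
  then obtain n where n: "n < length xs" "j = xs ! n" by (auto simp: in_set_conv_nth)
  have dist: "distinct xs"
    using sorted by (metis distinct_map strict_sorted_iff)
  have m0: "Suc n mod length xs < length xs" using n by (metis gr_implies_not0 mod_less_divisor neq0_conv)
  show ?thesis
    unfolding n(2) cyclic_pairs_nth[OF dist n(1)] circle_succ_nth[OF n(1)]
    using m0 n sorted_positions_inj by (auto dest: inj_onD)
next
  case False
  then show ?thesis using cyclic_pairs_subset by fast
qed

lemma sum_arcs:
  assumes "xs \<noteq> []"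
  shows "(\<Sum>j\<in>set xs. oriented_dist L (z j) (circle_succ L (z ` set xs) (z j))) = L"
proof -
  let ?n = "length xs"
  obtain n' where n': "?n = Suc n'" using assms by (cases xs) auto
  have dist: "distinct xs"
    using sorted by (metis distinct_map strict_sorted_iff)
  have "(\<Sum>j\<in>set xs. oriented_dist L (z j) (circle_succ L (z ` set xs) (z j)))
    = (\<Sum>n<?n. oriented_dist L (z (xs ! n)) (z (xs ! (Suc n mod ?n))))"
    using sum.reindex_bij_betw[OF bij_betw_nth[OF dist refl refl], of "\<lambda>j. oriented_dist L (z j) (circle_succ L (z ` set xs) (z j))"]
    by (simp add: circle_succ_nth)
  \<comment> \<open>The arcs telescope; the last one passes the base point, which is where the
    summand \<open>L\<close> comes from.\<close>
  also have "\<dots> = (\<Sum>n<n'. D (xs ! Suc n) - D (xs ! n)) + (D (xs ! 0) - D (xs ! n') + L)"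
    unfolding n' sum.lessThan_Suc
    by (intro arg_cong2[where f = "(+)"] sum.cong) (auto simp: sorted_positions_dist n')
  also have "\<dots> = L" using sum_lessThan_telescope[of "\<lambda>n. D (xs ! n)" n'] by simp
  finally show ?thesis .
qed

end

text \<open>Sorting by the offset from \<open>z b\<close> modulo \<open>L\<close> makes
  \<open>b\<close> the first entry, because its own offset is 0 and the others are not
  negative.\<close>

lemma circle_positions_sorted:
  fixes z :: "'a \<Rightarrow> real"
  assumes L: "0 < L" and N: "finite N" "inj_on z N" "z ` N \<subseteq> {0..<L}" "b \<in> N"
  obtains ps D where "distinct (b # ps)" "set (b # ps) = N" "sorted_wrt (<) (map D (b # ps))"
    "\<And>j. j \<in> N \<Longrightarrow> D j \<in> {0..<L}" "\<And>j. j \<in> N \<Longrightarrow> z j = (z b + D j) rmod L"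
proof -
  define D where "D j = (z j - z b) rmod L" for j
  have zb: "z b \<in> {0..<L}" using N by auto
  have Dj: "D j \<in> {0..<L}" for j using L by (auto simp: D_def rmod_nonneg rmod_less)
  have zD: "z j = (z b + D j) rmod L" if "j \<in> N" for j
  proof -
    have "(z b + D j) rmod L = (z b + (z j - z b)) rmod L"
      using rmod_add[of "z b" L "z j - z b"] zb L unfolding D_def by simp
    then show ?thesis using that N by auto
  qed
  have inj: "inj_on D N" using zD N(2) by (metis inj_onD inj_onI)
  define ds where "ds = sorted_list_of_set (D ` N)"
  define xs where "xs = map (inv_into N D) ds"
  have ds: "set ds = D ` N" "distinct ds" "sorted_wrt (<) ds"
    using N(1) by (auto simp: ds_def)
  have mapD: "map D xs = ds"
    unfolding xs_def using ds(1) by (auto intro!: map_idI simp: f_inv_into_f)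
  have set: "set xs = N"
    unfolding xs_def using ds(1) inj by (auto simp: image_image)
  have "xs \<noteq> []" using set N(4) by auto
  then obtain x ps where xs: "xs = x # ps" by (cases xs) auto
  have "x = b"
  proof (rule ccontr)
    assume "x \<noteq> b"
    then have "b \<in> set ps" using set N(4) xs by auto
    then have "D x < D b" using ds(3) unfolding mapD[symmetric] xs by auto
    moreover have "D b = 0" by (simp add: D_def)
    ultimately show False using Dj[of x] by auto
  qed
  moreover have "distinct xs" using ds(2) mapD by (metis distinct_map)
  ultimately show ?thesis
    using that[of ps D] set xs ds(3) mapD Dj zD by auto
qed

text \<open>The points are placed at the partial sums of the prescribed lengths, starting at
  parameter 0. The last arc closes the circle because the lengths add up to
  \<open>L\<close>.\<close>

lemma circle_realization:
  assumes xs: "distinct xs" "xs \<noteq> []" and a: "\<And>j. j \<in> set xs \<Longrightarrow> 0 < a j" "sum a (set xs) = L"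
  obtains z :: "'a \<Rightarrow> real" where "inj_on z (set xs)" "z ` set xs \<subseteq> {0..<L}"
    "\<And>j j'. (j, j') \<in> cyclic_pairs xs \<longleftrightarrow> j \<in> set xs \<and> j' \<in> set xs \<and> z j' = circle_succ L (z ` set xs) (z j)"
    "\<And>j. j \<in> set xs \<Longrightarrow> oriented_dist L (z j) (circle_succ L (z ` set xs) (z j)) = a j"
proof -
  let ?n = "length xs"
  define z where "z j = (\<Sum>m<inv_into {..<?n} ((!) xs) j. a (xs ! m))" for j
  have z: "z (xs ! n) = (\<Sum>m<n. a (xs ! m))" if "n < ?n" for n
    unfolding z_def using that xs(1) by (subst inv_into_f_f) (auto simp: inj_on_nth)
  have pos: "0 < a (xs ! n)" if "n < ?n" for n using a that by simp
  have total: "(\<Sum>m<?n. a (xs ! m)) = L"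
    using sum.reindex_bij_betw[OF bij_betw_nth[OF xs(1) refl refl], of a] a(2) by simp
  have less: "(\<Sum>m<n. a (xs ! m)) < (\<Sum>m<n'. a (xs ! m))" if "n < n'" "n' \<le> ?n" for n n'
    using that pos by (intro sum_strict_mono2[of _ _ n]) (auto intro: less_imp_le)
  have bd: "z j \<in> {0..<L}" if j: "j \<in> set xs" for j
  proof -
    obtain n where n: "n < ?n" "j = xs ! n" using j by (metis in_set_conv_nth)
    have "0 \<le> (\<Sum>m<n. a (xs ! m))" using n pos by (intro sum_nonneg) (auto intro: less_imp_le)
    then show ?thesis using n z less[of n ?n] total by simp
  qed
  have L: "0 < L" using bd xs(2) by (metis atLeastLessThan_iff last_in_set order_le_less_trans)
  have sorted: "sorted_wrt (<) (map z xs)"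
    unfolding sorted_wrt_iff_nth_less using less z by auto
  have "\<forall>j\<in>set xs. z j \<in> {0..<L}" "\<forall>j\<in>set xs. z j = (0 + z j) rmod L" using bd L by auto
  note ctx = L sorted this
  have "oriented_dist L (z j) (circle_succ L (z ` set xs) (z j)) = a j" if j: "j \<in> set xs" for j
  proof -
    obtain n where n: "n < ?n" "j = xs ! n" using j by (metis in_set_conv_nth)
    have m0: "Suc n mod ?n < ?n" using n by (metis gr_implies_not0 mod_less_divisor neq0_conv)
    have arc: "oriented_dist L (z j) (circle_succ L (z ` set xs) (z j))
      = (if n < Suc n mod ?n then z (xs ! (Suc n mod ?n)) - z (xs ! n) else z (xs ! (Suc n mod ?n)) - z (xs ! n) + L)"
      unfolding n(2) circle_succ_nth[OF ctx n(1)] by (rule sorted_positions_dist[OF ctx n(1) m0])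
    show ?thesis
    proof (cases "Suc n < ?n")
      case True
      then show ?thesis unfolding arc using n by (simp add: z)
    next
      case False
      with n have "Suc n = ?n" by simp
      moreover have "L = (\<Sum>m<n. a (xs ! m)) + a (xs ! n)"
        unfolding total[symmetric] \<open>Suc n = ?n\<close>[symmetric] by simp
      moreover have "z (xs ! 0) = 0" using z[of 0] xs(2) by simp
      ultimately show ?thesis unfolding arc using n by (simp add: z)
    qed
  qed
  moreover have "z ` set xs \<subseteq> {0..<L}" using bd by (rule image_subsetI)
  ultimately show ?thesis
    using that[of z] sorted_positions_inj[OF ctx] circle_succ_iff_cyclic_pairs[OF ctx] by blast
qed

text \<open>The angle is read off at the first point. Each further point is the preceding one plus
  an arc length modulo \<open>L\<close>, so the same angle works all along the list.\<close>

lemma equal_arcs_rotation: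
  assumes L: "0 < L" and z: "z ` set xs \<subseteq> {0..<L}" "z' ` set xs \<subseteq> {0..<L}"
    and arcs: "\<And>n. Suc n < length xs \<Longrightarrow>
      oriented_dist L (z (xs ! n)) (z (xs ! Suc n)) = oriented_dist L (z' (xs ! n)) (z' (xs ! Suc n))"
  shows "\<exists>\<theta>. \<forall>j\<in>set xs. z' j = (z j + \<theta>) rmod L"
proof -
  define \<theta> where "\<theta> = z' (xs ! 0) - z (xs ! 0)"
  have "z' (xs ! n) = (z (xs ! n) + \<theta>) rmod L" if "n < length xs" for n
    using that
  proof (induction n)
    case 0
    then have "z' (xs ! 0) \<in> {0..<L}" using z(2) by (metis image_subset_iff nth_mem)
    then show ?case using L by (simp add: \<theta>_def)
  next
    case (Suc n)
    let ?d = "oriented_dist L (z (xs ! n)) (z (xs ! Suc n))"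
    have mem: "z (xs ! Suc n) \<in> {0..<L}" "z' (xs ! Suc n) \<in> {0..<L}"
      using z Suc.prems by (meson image_subset_iff nth_mem)+
    have "z' (xs ! Suc n) = (z' (xs ! n) + ?d) rmod L"
      using add_oriented_dist[OF L mem(2)] Suc.prems arcs[of n] by simp
    also have "\<dots> = ((z (xs ! n) + \<theta>) + ?d) rmod L"
      using Suc by (metis Suc_lessD rmod_add rmod_rmod)
    also have "\<dots> = ((z (xs ! n) + ?d) + \<theta>) rmod L" by (simp add: algebra_simps)
    also have "\<dots> = (z (xs ! Suc n) + \<theta>) rmod L"
      using add_oriented_dist[OF L mem(1)] by (metis rmod_add rmod_rmod)
    finally show ?case .
  qed
  then show ?thesis by (intro exI[of _ \<theta>]) (metis in_set_conv_nth)
qed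

section \<open>Volumes of products of simplices\<close>

text \<open>A product of open corner simplices, one for each \<open>i\<close>. The strict inequality
  on the sum expresses that the omitted arc of circle \<open>i\<close> has positive length.\<close>

definition arc_simplices :: "'a set \<Rightarrow> ('a \<times> 'b) set \<Rightarrow> ('a \<Rightarrow> real) \<Rightarrow> ('a \<times> 'b \<Rightarrow> real) set" where
  "arc_simplices I A l =
    {x \<in> extensional A. (\<forall>e\<in>A. 0 < x e) \<and> (\<forall>i\<in>I. (\<Sum>j\<in>A `` {i}. x (i, j)) < l i)}"

lemma sets_arc_simplices:
  assumes "finite I" "finite A"
  shows "arc_simplices I A l \<in> sets (PiM A (\<lambda>_. lborel))"
proof -
  have [measurable]: "(\<lambda>x. x e) \<in> borel_measurable (PiM A (\<lambda>_. lborel))" if "e \<in> A" for e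
    using measurable_component_singleton[OF that, of "\<lambda>_. lborel"] by simp
  have "arc_simplices I A l = {x \<in> space (PiM A (\<lambda>_. lborel)). (\<forall>e\<in>A. 0 < x e) \<and> (\<forall>i\<in>I. (\<Sum>j\<in>A `` {i}. x (i, j)) < l i)}"
    by (auto simp: arc_simplices_def space_PiM PiE_def)
  also have "\<dots> \<in> sets (PiM A (\<lambda>_. lborel))"
  proof (intro sets.sets_Collect_conj sets.sets_Collect_finite_All assms)
    show "{x \<in> space (PiM A (\<lambda>_. lborel)). 0 < (x e :: real)} \<in> sets (PiM A (\<lambda>_. lborel))" if "e \<in> A" for e
      using that by measurable
    show "{x \<in> space (PiM A (\<lambda>_. lborel)). (\<Sum>j\<in>A `` {i}. x (i, j)) < l i} \<in> sets (PiM A (\<lambda>_. lborel))" for i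
    proof -
      have "(\<lambda>x. \<Sum>j\<in>A `` {i}. x (i, j)) \<in> borel_measurable (PiM A (\<lambda>_. lborel))"
        by (intro borel_measurable_sum) auto
      then show ?thesis by measurable
    qed
  qed
  finally show ?thesis .
qed

lemma nn_integral_power_interval:
  assumes "0 < (L::real)"
  shows "(\<integral>\<^sup>+y. indicator {0<..<L} y * ennreal ((L - y) ^ d / fact d) \<partial>lborel)
    = ennreal (L ^ Suc d / fact (Suc d))"
proof -
  have "(\<integral>\<^sup>+y. indicator {0<..<L} y * ennreal ((L - y) ^ d / fact d) \<partial>lborel)
      = (\<integral>\<^sup>+y. ennreal ((L - y) ^ d / fact d) * indicator {0..L} y \<partial>lborel)"
  \<comment> \<open>The end points form a null set, and closing the interval makes the fundamental
    theorem of calculus applicable.\<close>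
  proof (rule nn_integral_cong_AE)
    have "AE y in lborel. y \<noteq> 0 \<and> y \<noteq> L" using AE_lborel_singleton by auto
    then show "AE y in lborel. indicator {0<..<L} y * ennreal ((L - y) ^ d / fact d)
       = ennreal ((L - y) ^ d / fact d) * indicator {0..L} y"
      by eventually_elim (auto simp: indicator_def)
  qed
  also have "\<dots> = ennreal (- ((L - L) ^ Suc d / fact (Suc d)) - - ((L - 0) ^ Suc d / fact (Suc d)))"
  proof (rule nn_integral_FTC_Icc)
    show "((\<lambda>y. - ((L - y) ^ Suc d / fact (Suc d))) has_real_derivative (L - y) ^ d / fact d) (at y)" for y
    proof -
      have "((\<lambda>y. (L - y) ^ Suc d) has_real_derivative - (real (Suc d) * (L - y) ^ d)) (at y)"
        by (rule derivative_eq_intros refl | simp)+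
      then have "((\<lambda>y. - ((L - y) ^ Suc d / fact (Suc d))) has_real_derivative
          - (- (real (Suc d) * (L - y) ^ d) / fact (Suc d))) (at y)"
        by (intro DERIV_minus DERIV_cdivide)
      then show ?thesis by (simp del: of_nat_Suc power_Suc)
    qed
  qed (use assms in auto)
  finally show ?thesis by simp
qed

lemma insert_Image_pair: "insert (i, j) A `` {i'} = (if i' = i then insert j (A `` {i'}) else A `` {i'})"
  by auto

text \<open>Fixing the coordinate of one arc of circle \<open>i\<close> at \<open>y\<close> leaves
  the same shape with \<open>l i\<close> shortened by \<open>y\<close>. The bound
  \<open>y < l i\<close> is stated separately because it keeps the shortened length positive for the
  induction on arcs.\<close>

lemma arc_simplices_insert:
  assumes "finite A" "(i, j) \<notin> A" "i \<in> I" "x \<in> extensional A"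
  shows "x((i, j) := y) \<in> arc_simplices I (insert (i, j) A) l \<longleftrightarrow>
    0 < y \<and> y < l i \<and> x \<in> arc_simplices I A (l(i := l i - y))"
proof -
  have fin: "finite (A `` {i'})" for i'
    using assms(1) by (rule finite_Image)
  have sum: "(\<Sum>j'\<in>insert (i, j) A `` {i'}. (x((i, j) := y)) (i', j'))
     = (\<Sum>j'\<in>A `` {i'}. x (i', j')) + (if i' = i then y else 0)" for i'
  proof -
    have "(\<Sum>j'\<in>A `` {i'}. (x((i, j) := y)) (i', j')) = (\<Sum>j'\<in>A `` {i'}. x (i', j'))"
      using assms(2) by (intro sum.cong) auto
    moreover have "j \<notin> A `` {i}" using assms(2) by auto
    ultimately show ?thesis using fin by (cases "i' = i") (simp_all add: insert_Image_pair del: fun_upd_apply, simp)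
  qed
  have "x((i, j) := y) \<in> extensional (insert (i, j) A)"
    using assms(4) by (auto simp: extensional_def)
  moreover have "(\<forall>e\<in>insert (i, j) A. 0 < (x((i, j) := y)) e) \<longleftrightarrow> 0 < y \<and> (\<forall>e\<in>A. 0 < x e)"
    using assms(2) by auto
  moreover have "y < l i" if "\<forall>e\<in>A. 0 < x e" "(\<Sum>j'\<in>A `` {i}. x (i, j')) < l i - y"
  proof -
    have "0 \<le> (\<Sum>j'\<in>A `` {i}. x (i, j'))" using that(1) by (intro sum_nonneg) (auto intro: less_imp_le)
    with that show ?thesis by linarith
  qed
  moreover have "(\<forall>i'\<in>I. (\<Sum>j'\<in>A `` {i'}. x (i', j')) + (if i' = i then y else 0) < l i')
      \<longleftrightarrow> (\<forall>i'\<in>I. (\<Sum>j'\<in>A `` {i'}. x (i', j')) < (l(i := l i - y)) i')"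
    by (intro ball_cong) (auto simp: less_diff_eq)
  moreover have "(\<Sum>j'\<in>A `` {i}. x (i, j')) < l i - y"
    if "\<forall>i'\<in>I. (\<Sum>j'\<in>A `` {i'}. x (i', j')) < (l(i := l i - y)) i'"
    using that assms(3) by (metis fun_upd_same)
  ultimately show ?thesis
    using assms(4) unfolding arc_simplices_def mem_Collect_eq sum by blast
qed

text \<open>By Fubini, one arc is integrated at a time, for all lengths \<open>l\<close>
  simultaneously: adding an arc to circle \<open>i\<close> turns
  \<open>(l i - y) ^ d / fact d\<close> into its integral over \<open>y\<close>, the next term of
  the same form, and leaves the factors of the other circles alone.\<close>

lemma emeasure_arc_simplices:
  fixes A :: "('a \<times> 'b) set"
  assumes "finite A" "finite I" "A \<subseteq> I \<times> UNIV" "\<And>i. i \<in> I \<Longrightarrow> 0 < l i"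
  shows "emeasure (PiM A (\<lambda>_. lborel)) (arc_simplices I A l)
    = ennreal (\<Prod>i\<in>I. l i ^ card (A `` {i}) / fact (card (A `` {i})))"
  using assms
proof (induction A arbitrary: l rule: finite_induct)
  case empty
  then have "arc_simplices I ({} :: ('a \<times> 'b) set) l = {\<lambda>_. undefined}"
    by (auto simp: arc_simplices_def)
  then show ?case by simp
next
  case (insert e A)
  obtain i j where e: "e = (i, j)" by (cases e)
  have i: "i \<in> I" using insert.prems e by auto
  let ?M = "\<lambda>A. PiM A (\<lambda>_. lborel)"
  let ?P = "\<lambda>A l i. l i ^ card (A `` {i}) / fact (card (A `` {i}))"
  let ?d = "card (A `` {i})"
  interpret product_sigma_finite "\<lambda>_. lborel" by standard
  have meas: "arc_simplices I (insert e A) l \<in> sets (?M (insert e A))"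
    using insert by (intro sets_arc_simplices) auto
  have "emeasure (?M (insert e A)) (arc_simplices I (insert e A) l)
     = (\<integral>\<^sup>+x. indicator (arc_simplices I (insert e A) l) x \<partial>?M (insert e A))"
    using meas by simp
  also have "\<dots> = (\<integral>\<^sup>+y. \<integral>\<^sup>+x. indicator (arc_simplices I (insert e A) l) (x(e := y)) \<partial>?M A \<partial>lborel)"
    using insert.hyps meas by (intro product_nn_integral_insert_rev) auto
  also have "\<dots> = (\<integral>\<^sup>+y. ennreal (\<Prod>i'\<in>I - {i}. ?P A l i') * (indicator {0<..<l i} y * ennreal ((l i - y) ^ ?d / fact ?d)) \<partial>lborel)"
  proof (rule nn_integral_cong)
    fix y :: real
    have "(\<integral>\<^sup>+x. indicator (arc_simplices I (insert e A) l) (x(e := y)) \<partial>?M A)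
        = (\<integral>\<^sup>+x. indicator {0<..<l i} y * indicator (arc_simplices I A (l(i := l i - y))) x \<partial>?M A)"
      using arc_simplices_insert[of A i j I _ y l] insert.hyps i
      by (intro nn_integral_cong) (auto simp: e space_PiM PiE_def indicator_def)
    also have "\<dots> = indicator {0<..<l i} y * emeasure (?M A) (arc_simplices I A (l(i := l i - y)))"
      using sets_arc_simplices[OF insert.prems(1) insert.hyps(1), of "l(i := l i - y)"]
      by (subst nn_integral_cmult) simp_all
    also have "\<dots> = ennreal (\<Prod>i'\<in>I - {i}. ?P A l i') * (indicator {0<..<l i} y * ennreal ((l i - y) ^ ?d / fact ?d))"
    proof (cases "y \<in> {0<..<l i}")
      case True
      then have pos: "\<And>i'. i' \<in> I \<Longrightarrow> 0 < (l(i := l i - y)) i'" using insert.prems(3) by simp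
      have "(\<Prod>i'\<in>I. ?P A (l(i := l i - y)) i') = ((l i - y) ^ ?d / fact ?d) * (\<Prod>i'\<in>I - {i}. ?P A (l(i := l i - y)) i')"
        using insert.prems(1) i by (subst prod.remove[of I i]) auto
      also have "(\<Prod>i'\<in>I - {i}. ?P A (l(i := l i - y)) i') = (\<Prod>i'\<in>I - {i}. ?P A l i')"
        by (intro prod.cong) auto
      finally have eq: "(\<Prod>i'\<in>I. ?P A (l(i := l i - y)) i') = ((l i - y) ^ ?d / fact ?d) * (\<Prod>i'\<in>I - {i}. ?P A l i')" .
      have "emeasure (?M A) (arc_simplices I A (l(i := l i - y))) = ennreal (\<Prod>i'\<in>I. ?P A (l(i := l i - y)) i')"
        by (rule insert.IH) (use insert.prems pos in auto)
      then have "emeasure (?M A) (arc_simplices I A (l(i := l i - y))) = ennreal (((l i - y) ^ ?d / fact ?d) * (\<Prod>i'\<in>I - {i}. ?P A l i'))"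
        unfolding eq .
      moreover have "0 \<le> (\<Prod>i'\<in>I - {i}. ?P A l i')"
        using insert.prems by (intro prod_nonneg) (auto intro: less_imp_le)
      ultimately have "emeasure (?M A) (arc_simplices I A (l(i := l i - y)))
          = ennreal ((l i - y) ^ ?d / fact ?d) * ennreal (\<Prod>i'\<in>I - {i}. ?P A l i')"
        by (simp only: ennreal_mult'')
      moreover have "indicator {0<..<l i} y = (1 :: ennreal)" using True by simp
      ultimately show ?thesis by (simp only: mult_1_left mult.commute)
    qed simp
    finally show "(\<integral>\<^sup>+x. indicator (arc_simplices I (insert e A) l) (x(e := y)) \<partial>?M A)
      = ennreal (\<Prod>i'\<in>I - {i}. ?P A l i') * (indicator {0<..<l i} y * ennreal ((l i - y) ^ ?d / fact ?d))" .
  qed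
  also have "\<dots> = ennreal (\<Prod>i'\<in>I - {i}. ?P A l i') * ennreal (l i ^ Suc ?d / fact (Suc ?d))"
    using insert.prems(3)[OF i] by (subst nn_integral_cmult) (simp_all add: nn_integral_power_interval del: fact_Suc power_Suc)
  also have "\<dots> = ennreal ((\<Prod>i'\<in>I - {i}. ?P A l i') * (l i ^ Suc ?d / fact (Suc ?d)))"
    using insert.prems by (intro ennreal_mult'[symmetric] prod_nonneg) (auto intro: less_imp_le)
  also have "(\<Prod>i'\<in>I - {i}. ?P A l i') * (l i ^ Suc ?d / fact (Suc ?d)) = (\<Prod>i'\<in>I. ?P (insert e A) l i')"
  proof -
    have "j \<notin> A `` {i}" using insert.hyps e by auto
    then have "card (insert e A `` {i}) = Suc ?d"
      using finite_Image[OF insert.hyps(1)] by (simp add: e insert_Image_pair)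
    moreover have "(\<Prod>i'\<in>I - {i}. ?P A l i') = (\<Prod>i'\<in>I - {i}. ?P (insert e A) l i')"
      by (intro prod.cong) (auto simp: e insert_Image_pair)
    ultimately show ?thesis
      using insert.prems(1) i by (subst prod.remove[of I i]) (simp_all add: mult.commute)
  qed
  finally show ?case .
qed

section \<open>Gluings without triple points\<close>

definition contact :: "gluing \<Rightarrow> (nat \<times> nat) set" where
  "contact R = {(i, j). i \<noteq> j \<and> (\<exists>x y. ((i, x), (j, y)) \<in> R)}"

lemma next_param_eq: "next_param l R i x = circle_succ (l i) (vertex_params R i) x"
  by (simp add: next_param_def circle_succ_def)

lemma circle_succ_in: "finite P \<Longrightarrow> P \<noteq> {} \<Longrightarrow> circle_succ L P x \<in> P"
  unfolding circle_succ_def by (rule arg_min_if_finite)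

context
  fixes k :: nat and l :: "nat \<Rightarrow> real" and R :: gluing
  assumes gl: "is_gluing k l R"
begin

lemma gluing_equiv: "equiv (circle_points k l) R"
  using gl by (simp add: is_gluing_def)

lemma gluing_sym: "(p, q) \<in> R \<Longrightarrow> (q, p) \<in> R"
  using gluing_equiv by (meson equivE symD)

lemma gluing_in_points: "(p, q) \<in> R \<Longrightarrow> p \<in> circle_points k l"
  using gluing_equiv by (auto simp: equiv_def refl_on_def)

lemma gluing_same_circle: "((i, x), (i, y)) \<in> R \<Longrightarrow> x = y"
  using gl by (auto simp: is_gluing_def)

lemma finite_gluing_params: "finite (gluing_params R i)"
proof (rule finite_subset)
  show "gluing_params R i \<subseteq> snd ` fst ` (R - Id)"
    unfolding gluing_params_def by (force simp: image_iff)
  show "finite (snd ` fst ` (R - Id))"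
    using gl by (simp add: is_gluing_def)
qed

lemma vertex_params_finite: "finite (vertex_params R i)" "vertex_params R i \<noteq> {}"
  using finite_gluing_params by (auto simp: vertex_params_def)

lemma next_param_in: "next_param l R i x \<in> vertex_params R i"
  unfolding next_param_eq using vertex_params_finite by (rule circle_succ_in)

lemma glued_graph_ends:
  assumes "e \<in> arcs (glued_graph k l R)"
  shows "tail (glued_graph k l R) e \<in> verts (glued_graph k l R) \<and> head (glued_graph k l R) e \<in> verts (glued_graph k l R)"
  using assms next_param_in by (auto simp: glued_graph_def)

lemma contact_subset: "contact R \<subseteq> {1..k} \<times> {1..k}"
  using gluing_in_points gluing_sym unfolding contact_def circle_points_def by blast

lemma sym_contact: "sym (contact R)"
  using gluing_sym unfolding sym_def contact_def by blast

lemma irrefl_contact: "irrefl (contact R)"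
  by (auto simp: contact_def irrefl_def)

lemma class_eq: "(p, q) \<in> R \<Longrightarrow> R `` {p} = R `` {q}"
  using gluing_equiv by (rule equiv_class_eq)

lemma self_class: "p \<in> circle_points k l \<Longrightarrow> p \<in> R `` {p}"
  using gluing_equiv by (rule equiv_class_self)

lemma class_contact: "(j, y) \<in> R `` {(i, x)} \<Longrightarrow> (i, j) \<in> (contact R)\<^sup>*"
  by (cases "i = j") (auto simp: contact_def)

lemma vertex_in_points:
  assumes "i \<in> {1..k}" "0 < l i" "x \<in> vertex_params R i"
  shows "(i, x) \<in> circle_points k l"
proof (cases "gluing_params R i = {}")
  case True
  then show ?thesis using assms by (auto simp: vertex_params_def circle_points_def)
next
  case False
  then have "x \<in> gluing_params R i" using assms(3) by (simp add: vertex_params_def)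
  then obtain q where "((i, x), q) \<in> R" by (auto simp: gluing_params_def)
  then show ?thesis by (rule gluing_in_points)
qed

text \<open>A walk in the glued graph stays on one circle while it follows an arc, and changes
  circles only inside a vertex, that is, between circles that touch.\<close>

lemma constellation_contact_connected:
  assumes l: "\<And>i. i \<in> {1..k} \<Longrightarrow> 0 < l i" and conn: "circle_constellation k l R"
    and ij: "i \<in> {1..k}" "j \<in> {1..k}"
  shows "(i, j) \<in> (contact R)\<^sup>*"
proof -
  let ?G = "glued_graph k l R"
  obtain x y where x: "x \<in> vertex_params R i" and y: "y \<in> vertex_params R j"
    using vertex_params_finite(2) by blast
  have "R `` {(i, x)} \<in> verts ?G" "R `` {(j, y)} \<in> verts ?G"
    using ij x y by (auto simp: glued_graph_def)
  then have path: "(R `` {(i, x)}, R `` {(j, y)}) \<in> (uadj ?G (arcs ?G))\<^sup>*"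
    using conn connected_iff_uadj[OF glued_graph_ends] by (auto simp: circle_constellation_def)
  \<comment> \<open>The invariant concerns all circles through the vertex reached, since the next
    arc may belong to any of them.\<close>
  have "\<forall>(a, u)\<in>v. (i, a) \<in> (contact R)\<^sup>*" if "(R `` {(i, x)}, v) \<in> (uadj ?G (arcs ?G))\<^sup>*" for v
    using that
  proof induction
    case base
    then show ?case using class_contact by blast
  next
    case (step v w)
    from step(2) obtain a u where a: "a \<in> {1..k}" "u \<in> vertex_params R a"
      and vw: "(v = R `` {(a, u)} \<and> w = R `` {(a, next_param l R a u)}) \<or>
         (w = R `` {(a, u)} \<and> v = R `` {(a, next_param l R a u)})"
      by (auto simp: uadj_def glued_graph_def)
    have "(a, u) \<in> R `` {(a, u)}" "(a, next_param l R a u) \<in> R `` {(a, next_param l R a u)}"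
      using a l next_param_in self_class vertex_in_points by blast+
    then have "(i, a) \<in> (contact R)\<^sup>*" using step.IH vw by blast
    moreover have "(a, b) \<in> (contact R)\<^sup>*" if "(b, t) \<in> w" for b t
      using that vw class_contact by blast
    ultimately show ?case by (auto intro: rtrancl_trans)
  qed
  with path have "\<forall>(a, u)\<in>R `` {(j, y)}. (i, a) \<in> (contact R)\<^sup>*" by blast
  moreover have "(j, y) \<in> R `` {(j, y)}"
    using ij y l self_class vertex_in_points by blast
  ultimately show ?thesis by blast
qed

end

text \<open>The assumption \<open>glued\<close> excludes circles with the artificial vertex, so that
  arcs, gluing points on circles and vertices can be counted against each other.\<close>

locale generic_gluing =
  fixes k :: nat and l :: "nat \<Rightarrow> real" and R :: gluing
  assumes gl: "is_gluing k l R" and generic: "no_triple_points R"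
    and glued: "\<And>i. i \<in> {1..k} \<Longrightarrow> gluing_params R i \<noteq> {}"
    and lpos: "\<And>i. i \<in> {1..k} \<Longrightarrow> 0 < l i"
begin

abbreviation "G \<equiv> glued_graph k l R"
abbreviation "M \<equiv> (SIGMA i:{1..k}. gluing_params R i)"

lemma vertex_params_eq: "i \<in> {1..k} \<Longrightarrow> vertex_params R i = gluing_params R i"
  using glued by (auto simp: vertex_params_def)

lemma arcs_G: "arcs G = M"
  using vertex_params_eq by (auto simp: glued_graph_def)

lemma verts_G: "verts G = (\<lambda>p. R `` {p}) ` M"
  using vertex_params_eq by (auto simp: glued_graph_def intro!: image_cong)

lemma finite_M: "finite M"
  using finite_gluing_params[OF gl] by auto

lemma partner_unique:
  assumes "(p, q) \<in> R" "(p, q') \<in> R" "q \<noteq> p" "q' \<noteq> p"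
  shows "q = q'"
proof (rule ccontr)
  assume "q \<noteq> q'"
  have "p \<in> R `` {p}" using self_class[OF gl] gluing_in_points[OF gl assms(1)] by blast
  then have sub: "{p, q, q'} \<subseteq> R `` {p}" using assms by auto
  have "R `` {p} \<subseteq> insert p (snd ` (R - Id))" by (force simp: image_iff)
  moreover have "finite (R - Id)" using gl by (simp add: is_gluing_def)
  ultimately have "finite (R `` {p})" by (meson finite_imageI finite_insert finite_subset)
  then have "card {p, q, q'} \<le> card (R `` {p})" using sub by (intro card_mono)
  also have "\<dots> \<le> 2" using generic unfolding no_triple_points_def by blast
  finally show False using assms \<open>q \<noteq> q'\<close> by simp
qed

lemma M_iff: "p \<in> M \<longleftrightarrow> (\<exists>q. q \<noteq> p \<and> (p, q) \<in> R)"
proof (cases p)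
  case (Pair i x)
  have "i \<in> {1..k}" if "((i, x), q) \<in> R" for q
    using gluing_in_points[OF gl that] by (simp add: circle_points_def)
  then show ?thesis unfolding Pair gluing_params_def by blast
qed

definition partner :: "point \<Rightarrow> point" where
  "partner p = (THE q. q \<noteq> p \<and> (p, q) \<in> R)"

lemma partner: "p \<in> M \<Longrightarrow> partner p \<noteq> p \<and> (p, partner p) \<in> R"
  unfolding partner_def M_iff
proof (rule theI')
  assume "\<exists>q. q \<noteq> p \<and> (p, q) \<in> R"
  then obtain q where "q \<noteq> p \<and> (p, q) \<in> R" ..
  then show "\<exists>!q. q \<noteq> p \<and> (p, q) \<in> R"
    by (rule ex1I) (metis partner_unique \<open>q \<noteq> p \<and> (p, q) \<in> R\<close>)
qed

lemma class_M:
  assumes "p \<in> M"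
  shows "R `` {p} = {p, partner p}"
proof
  note p = partner[OF assms]
  show "R `` {p} \<subseteq> {p, partner p}"
  proof
    fix q assume "q \<in> R `` {p}"
    then show "q \<in> {p, partner p}"
      using partner_unique[of p q "partner p"] p by (cases "q = p") auto
  qed
  have "p \<in> circle_points k l" using p gluing_in_points[OF gl] by blast
  then show "{p, partner p} \<subseteq> R `` {p}" using p self_class[OF gl] by simp
qed

lemma partner_in_M:
  assumes "p \<in> M"
  shows "partner p \<in> M"
  unfolding M_iff using partner[OF assms] gluing_sym[OF gl, of p] by (intro exI[of _ p]) auto

text \<open>The vertices are the classes \<open>{p, partner p}\<close>, and these partition
  \<open>M\<close>.\<close>

lemma card_M: "card M = 2 * card (verts G)"
proof -
  have un: "\<Union>(verts G) = M"
  proof (intro equalityI subsetI)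
    fix q assume "q \<in> \<Union>(verts G)"
    then obtain p where "p \<in> M" "q \<in> R `` {p}" unfolding verts_G by blast
    then show "q \<in> M" using class_M[of p] partner_in_M[of p] by auto
  next
    fix p assume "p \<in> M"
    then show "p \<in> \<Union>(verts G)" unfolding verts_G using class_M[of p] by blast
  qed
  have "2 * card (verts G) = card (\<Union>(verts G))"
  proof (rule card_partition)
    show "finite (verts G)" using finite_M by (simp add: verts_G)
    show "finite (\<Union>(verts G))" unfolding un by (rule finite_M)
    show "card c = 2" if "c \<in> verts G" for c
    proof -
      obtain p where "p \<in> M" "c = R `` {p}" using \<open>c \<in> verts G\<close> unfolding verts_G by blast
      then have "c = {p, partner p}" "partner p \<noteq> p" using class_M[of p] partner[of p] by auto
      then show ?thesis by simp
    qed
    show "c \<inter> c' = {}" if "c \<in> verts G" "c' \<in> verts G" "c \<noteq> c'" for c c'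
    proof (rule ccontr)
      assume "c \<inter> c' \<noteq> {}"
      then obtain q where q: "q \<in> c" "q \<in> c'" by blast
      obtain p p' where "c = R `` {p}" "c' = R `` {p'}" using \<open>c \<in> verts G\<close> \<open>c' \<in> verts G\<close> unfolding verts_G by blast
      with q have "c = R `` {q}" "c' = R `` {q}" by (auto simp: class_eq[OF gl])
      with \<open>c \<noteq> c'\<close> show False by simp
    qed
  qed
  then show ?thesis by (simp add: un)
qed

lemma partner_eq: "((i, x), (j, y)) \<in> R \<Longrightarrow> i \<noteq> j \<Longrightarrow> (i, x) \<in> M \<and> partner (i, x) = (j, y)"
proof -
  assume e: "((i, x), (j, y)) \<in> R" "i \<noteq> j"
  then have m: "(i, x) \<in> M" unfolding M_iff by (intro exI[of _ "(j, y)"]) auto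
  then show ?thesis
    using partner[OF m] partner_unique[of "(i, x)" "partner (i, x)" "(j, y)"] e by auto
qed

text \<open>An arc is sent to its own circle together with the circle glued to it where it begins.
  Once the two sides have equally many elements, this map is injective, which says that two circles
  touch at most once.\<close>

lemma contact_subset_image: "contact R \<subseteq> (\<lambda>p. (fst p, fst (partner p))) ` M"
proof
  fix e assume "e \<in> contact R"
  then obtain i j x y where e: "e = (i, j)" "i \<noteq> j" "((i, x), (j, y)) \<in> R" by (auto simp: contact_def)
  show "e \<in> (\<lambda>p. (fst p, fst (partner p))) ` M"
    using partner_eq[OF e(3,2)] e(1) by force
qed

lemma card_contact_le: "card (contact R) \<le> card M"
  using contact_subset_image finite_M by (meson card_image_le card_mono finite_imageI order_trans)

lemma circle_list:
  assumes "i \<in> {1..k}" "b \<in> gluing_params R i"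
  obtains ps where "distinct (b # ps)" "set (b # ps) = gluing_params R i"
    "\<And>n. n < length (b # ps) \<Longrightarrow> next_param l R i ((b # ps) ! n) = (b # ps) ! (Suc n mod length (b # ps))"
proof -
  have sub: "id ` gluing_params R i \<subseteq> {0..<l i}"
    using gluing_in_points[OF gl] by (fastforce simp: gluing_params_def circle_points_def)
  obtain ps D where ps: "distinct (b # ps)" "set (b # ps) = gluing_params R i" "sorted_wrt (<) (map D (b # ps))"
      "\<And>j. j \<in> gluing_params R i \<Longrightarrow> D j \<in> {0..<l i}" "\<And>j. j \<in> gluing_params R i \<Longrightarrow> id j = (id b + D j) rmod l i"
    using circle_positions_sorted[OF lpos[OF assms(1)] finite_gluing_params[OF gl] _ sub assms(2)] by auto
  have "circle_succ (l i) (id ` set (b # ps)) (id ((b # ps) ! n)) = id ((b # ps) ! (Suc n mod length (b # ps)))"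
    if "n < length (b # ps)" for n
    using lpos[OF assms(1)] ps(3) _ _ that by (rule circle_succ_nth) (use ps in blast)+
  then show ?thesis
    using that[OF ps(1,2)] ps(2) unfolding next_param_eq vertex_params_eq[OF assms(1)] by simp
qed

lemma next_param_surj:
  assumes "i \<in> {1..k}" "x \<in> gluing_params R i"
  obtains y where "y \<in> gluing_params R i" "next_param l R i y = x"
proof -
  obtain ps where ps: "distinct (x # ps)" "set (x # ps) = gluing_params R i"
    "\<And>n. n < length (x # ps) \<Longrightarrow> next_param l R i ((x # ps) ! n) = (x # ps) ! (Suc n mod length (x # ps))"
    using circle_list[OF assms] by blast
  have "next_param l R i ((x # ps) ! length ps) = x" using ps(3)[of "length ps"] by simp
  moreover have "(x # ps) ! length ps \<in> gluing_params R i" using ps(2) by (metis length_Cons lessI nth_mem)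
  ultimately show ?thesis using that by blast
qed

section \<open>Deleting one arc of each circle\<close>

definition cut :: "(nat \<Rightarrow> real) \<Rightarrow> point set" where
  "cut c = M - (\<lambda>i. (i, c i)) ` {1..k}"

lemma card_cut:
  assumes "\<And>i. i \<in> {1..k} \<Longrightarrow> c i \<in> gluing_params R i"
  shows "card (cut c) + k = card M"
proof -
  let ?X = "(\<lambda>i. (i, c i)) ` {1..k}"
  have "card ?X = k" by (subst card_image) (auto simp: inj_on_def)
  moreover have X: "?X \<subseteq> M" using assms by auto
  ultimately show ?thesis
    unfolding cut_def using card_Diff_subset[OF _ X] card_mono[OF finite_M X] by simp
qed

lemma cut_circle_connected:
  assumes c: "\<And>i. i \<in> {1..k} \<Longrightarrow> c i \<in> gluing_params R i"
    and i: "i \<in> {1..k}" "x \<in> gluing_params R i" "y \<in> gluing_params R i"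
  shows "(R `` {(i, x)}, R `` {(i, y)}) \<in> (uadj G (cut c))\<^sup>*"
proof -
  \<comment> \<open>Listing the circle from the point after \<open>c i\<close> makes the deleted arc
    the wrap-around arc from the last entry to the first, so all other arcs form a path along the
    list.\<close>
  let ?b = "next_param l R i (c i)"
  have b: "?b \<in> gluing_params R i" using next_param_in[OF gl, of i] vertex_params_eq[OF i(1)] by simp
  obtain ps where ps: "distinct (?b # ps)" "set (?b # ps) = gluing_params R i"
    "\<And>n. n < length (?b # ps) \<Longrightarrow> next_param l R i ((?b # ps) ! n) = (?b # ps) ! (Suc n mod length (?b # ps))"
    using circle_list[OF i(1) b] by blast
  define xs where "xs = ?b # ps"
  note ps = ps[folded xs_def]
  obtain a where a: "a < length xs" "xs ! a = c i" using c[OF i(1)] ps(2) by (metis in_set_conv_nth)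
  have "xs ! 0 = xs ! (Suc a mod length xs)" using ps(3)[OF a(1)] a(2) by (simp add: xs_def)
  then have "Suc a mod length xs = 0" using ps(1) a(1)
    by (metis gr_implies_not0 mod_less_divisor neq0_conv nth_eq_iff_index_eq)
  then have last: "Suc a = length xs" using a(1) by (metis Suc_lessI mod_less nat.distinct(1))
  have from0: "(R `` {(i, xs ! 0)}, R `` {(i, xs ! n)}) \<in> (uadj G (cut c))\<^sup>*" if "n < length xs" for n
    using that
  proof (induction n)
    case (Suc n)
    have "xs ! n \<noteq> c i" using Suc.prems a last ps(1) by (metis Suc_lessD less_SucI less_irrefl nat.inject nth_eq_iff_index_eq)
    moreover have "xs ! n \<in> gluing_params R i" using Suc.prems ps(2) by (metis Suc_lessD nth_mem)
    ultimately have "(i, xs ! n) \<in> cut c" using i(1) by (auto simp: cut_def)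
    moreover have "next_param l R i (xs ! n) = xs ! Suc n" using ps(3)[of n] Suc.prems by simp
    ultimately have "(R `` {(i, xs ! n)}, R `` {(i, xs ! Suc n)}) \<in> uadj G (cut c)"
      unfolding uadj_iff by (intro bexI[of _ "(i, xs ! n)"]) (auto simp: glued_graph_def)
    then show ?case using Suc by (meson Suc_lessD rtrancl.rtrancl_into_rtrancl)
  qed simp
  then have "(R `` {(i, xs ! 0)}, R `` {(i, t)}) \<in> (uadj G (cut c))\<^sup>*" if "t \<in> gluing_params R i" for t
    using that ps(2) by (metis in_set_conv_nth)
  then show ?thesis using i uadj_rtrancl_sym by (meson rtrancl_trans)
qed

lemma head_G: "head G (i, x) = R `` {(i, next_param l R i x)}"
  by (simp add: glued_graph_def)

lemma tail_G: "tail G p = R `` {p}"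
  by (simp add: glued_graph_def)

text \<open>A walk on the circles lifts to the cut graph: each circle remains a path through all of
  its gluing points, and touching circles share a vertex.\<close>

lemma contact_connected_imp_cut_connected:
  assumes conn: "\<And>i j. i \<in> {1..k} \<Longrightarrow> j \<in> {1..k} \<Longrightarrow> (i, j) \<in> (contact R)\<^sup>*"
    and c: "\<And>i. i \<in> {1..k} \<Longrightarrow> c i \<in> gluing_params R i"
    and uv: "u \<in> verts G" "v \<in> verts G"
  shows "(u, v) \<in> (uadj G (cut c))\<^sup>*"
proof -
  obtain i x j y where u: "u = R `` {(i, x)}" "i \<in> {1..k}" "x \<in> gluing_params R i"
    and v: "v = R `` {(j, y)}" "j \<in> {1..k}" "y \<in> gluing_params R j"
    using uv unfolding verts_G by blast
  have "\<forall>y\<in>gluing_params R j. (R `` {(i, x)}, R `` {(j, y)}) \<in> (uadj G (cut c))\<^sup>*"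
    using conn[OF u(2) v(2)]
  proof induction
    case base
    then show ?case using cut_circle_connected[OF c u(2,3)] by blast
  next
    case (step a b)
    then obtain s t where st: "((a, s), (b, t)) \<in> R" "a \<noteq> b" by (auto simp: contact_def)
    have s: "s \<in> gluing_params R a"
      unfolding gluing_params_def mem_Collect_eq using st by (intro exI[of _ "(b, t)"]) auto
    have t: "t \<in> gluing_params R b"
      unfolding gluing_params_def mem_Collect_eq using st gluing_sym[OF gl st(1)] by (intro exI[of _ "(a, s)"]) auto
    have "b \<in> {1..k}" using contact_subset[OF gl] step(2) by blast
    then have "(R `` {(b, t)}, R `` {(b, y)}) \<in> (uadj G (cut c))\<^sup>*" if "y \<in> gluing_params R b" for y
      using cut_circle_connected[OF c _ t that] by blast
    moreover have "(R `` {(i, x)}, R `` {(b, t)}) \<in> (uadj G (cut c))\<^sup>*"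
      using step.IH s class_eq[OF gl st(1)] by metis
    ultimately show ?case by (meson rtrancl_trans)
  qed
  then show ?thesis using u v by blast
qed

lemma cut_choice:
  obtains c where "\<And>i. i \<in> {1..k} \<Longrightarrow> c i \<in> gluing_params R i"
  using that[of "\<lambda>i. SOME x. x \<in> gluing_params R i"] glued by (simp add: some_in_eq)

lemma cut_subset: "cut c \<subseteq> arcs G"
  by (auto simp: cut_def arcs_G)

lemma cut_ends: "e \<in> cut c \<Longrightarrow> tail G e \<in> verts G \<and> head G e \<in> verts G"
  using glued_graph_ends[OF gl] cut_subset by blast

lemma finite_verts: "finite (verts G)"
  using finite_M by (simp add: verts_G)

text \<open>For \<open>v\<close> vertices, the \<open>2 * v - k\<close> remaining arcs contain no
  cycle, so \<open>v\<close> is at most \<open>k - 1\<close>. Only this bound is taken from the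
  cactus property; the opposite one comes from the contact graph, which is connected on
  \<open>k\<close> circles.\<close>

lemma cactus_card_M_le:
  assumes "circle_cactus k l R" "1 \<le> k"
  shows "card M \<le> 2 * (k - 1)"
proof -
  obtain c where c: "\<And>i. i \<in> {1..k} \<Longrightarrow> c i \<in> gluing_params R i"
    using cut_choice by blast
  have conn: "(i, j) \<in> (contact R)\<^sup>*" if "i \<in> {1..k}" "j \<in> {1..k}" for i j
    using constellation_contact_connected[OF gl lpos _ that] assms(1) by (simp add: circle_cactus_def)
  have r: "R `` {(1, c 1)} \<in> verts G" using c assms(2) by (auto simp: verts_G)
  have "\<not> set es \<subseteq> cut c" if es: "undirected_cycle G es" for es
  proof
    assume sub: "set es \<subseteq> cut c"
    obtain i where "i \<in> {1..k}" "set es = {i} \<times> vertex_params R i"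
      using assms(1) es by (auto simp: circle_cactus_def)
    then have "(i, c i) \<in> set es" "i \<in> {1..k}" using c vertex_params_eq by auto
    with sub show False by (auto simp: cut_def)
  qed
  then have "card (cut c) + 1 \<le> card (verts G)"
    by (intro acyclic_connected_card_le[OF finite_verts r cut_subset cut_ends]
        contact_connected_imp_cut_connected conn c r) auto
  with card_cut[OF c] card_M show ?thesis by linarith
qed

text \<open>There are \<open>k - 1\<close> vertices, and every cut leaves a connected graph with
  \<open>k - 2\<close> arcs, which has no room for a cycle. This forces a cycle to contain some full
  circle, and minimality of cycles then gives equality.\<close>

lemma cactus_if_card_M:
  assumes conn: "\<And>i j. i \<in> {1..k} \<Longrightarrow> j \<in> {1..k} \<Longrightarrow> (i, j) \<in> (contact R)\<^sup>*"
    and card: "card M = 2 * (k - 1)" and k: "2 \<le> k"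
  shows "circle_cactus k l R"
proof -
  obtain c0 where c0: "\<And>i. i \<in> {1..k} \<Longrightarrow> c0 i \<in> gluing_params R i"
    using cut_choice by blast
  have r: "R `` {(1, c0 1)} \<in> verts G" using c0 k by (auto simp: verts_G)
  have "(u, v) \<in> (uadj G (arcs G))\<^sup>*" if "u \<in> verts G" "v \<in> verts G" for u v
    using contact_connected_imp_cut_connected[OF conn c0 that] rtrancl_mono[OF uadj_mono[OF cut_subset]] by blast
  then have "Digraph_Component.connected G"
    using r by (subst connected_iff_uadj[OF glued_graph_ends[OF gl]]) auto
  then have "circle_constellation k l R" using gl by (simp add: circle_constellation_def)
  moreover have "\<exists>i\<in>{1..k}. set es = {i} \<times> vertex_params R i" if es: "undirected_cycle G es" for es
  proof -
    \<comment> \<open>Otherwise the arcs to be deleted can be chosen outside the cycle, and the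
      cycle survives the cut.\<close>
    have "\<exists>i\<in>{1..k}. {i} \<times> gluing_params R i \<subseteq> set es"
    proof (rule ccontr)
      assume "\<not> ?thesis"
      then have "\<forall>i\<in>{1..k}. \<exists>x. x \<in> gluing_params R i \<and> (i, x) \<notin> set es" by fastforce
      then obtain c where c: "\<And>i. i \<in> {1..k} \<Longrightarrow> c i \<in> gluing_params R i"
        and out: "\<And>i. i \<in> {1..k} \<Longrightarrow> (i, c i) \<notin> set es" by metis
      have "set es \<subseteq> cut c"
        using es out unfolding undirected_cycle_def cut_def arcs_G by auto
      moreover have "finite (cut c)" using finite_M by (simp add: cut_def)
      ultimately have "card (verts G) \<le> card (cut c)"
        by (intro connected_with_cycle_card_ge[OF finite_verts r _ cut_ends _ es]
          contact_connected_imp_cut_connected conn c r) auto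
      with card_cut[OF c] card_M card k show False by linarith
    qed
    then obtain i where i: "i \<in> {1..k}" "{i} \<times> gluing_params R i \<subseteq> set es" by blast
    \<comment> \<open>On a circle with at least two arcs, each arc shares its tail with the
      preceding arc and its head with the following one.\<close>
    have "{i} \<times> gluing_params R i = set es"
      using es i(2)
    proof (rule cycle_arcs_minimal)
      show "{i} \<times> gluing_params R i \<noteq> {}" using glued[OF i(1)] by auto
      fix e v assume e: "e \<in> {i} \<times> gluing_params R i" "tail G e \<noteq> head G e" "v \<in> {tail G e, head G e}"
      then obtain x where x: "e = (i, x)" "x \<in> gluing_params R i" by auto
      from e(3) show "\<exists>f\<in>{i} \<times> gluing_params R i. f \<noteq> e \<and> v \<in> {tail G f, head G f}"
      proof
        assume v: "v = tail G e"
        obtain y where y: "y \<in> gluing_params R i" "next_param l R i y = x"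
          using next_param_surj[OF i(1) x(2)] by blast
        then have "v = head G (i, y)" using v x(1) by (simp add: head_G tail_G)
        moreover from this have "(i, y) \<noteq> e" using e(2) v by auto
        ultimately show ?thesis using y(1) by blast
      next
        assume "v \<in> {head G e}"
        then have v: "v = tail G (i, next_param l R i x)" "v = head G e" using x(1) by (auto simp: head_G tail_G)
        then have "(i, next_param l R i x) \<noteq> e" using e(2) by auto
        moreover have "next_param l R i x \<in> gluing_params R i"
          using next_param_in[OF gl, of i] vertex_params_eq[OF i(1)] by simp
        ultimately show ?thesis using v(1) by blast
      qed
    qed
    then have "set es = {i} \<times> vertex_params R i" using vertex_params_eq[OF i(1)] by simp
    then show ?thesis using i(1) by blast
  qed
  ultimately show ?thesis by (simp add: circle_cactus_def)
qed

end

section \<open>Cacti from trees\<close>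

text \<open>\<open>z i j\<close> is the parameter, on circle \<open>i\<close>, of its common point with circle \<open>j\<close>.\<close>

definition glue :: "nat \<Rightarrow> (nat \<Rightarrow> real) \<Rightarrow> (nat \<times> nat) set \<Rightarrow> (nat \<Rightarrow> nat \<Rightarrow> real) \<Rightarrow> gluing" where
  "glue k l E z = Id_on (circle_points k l) \<union> (\<lambda>(i, j). ((i, z i j), (j, z j i))) ` E"

text \<open>Injectivity of \<open>z i\<close> keeps the contacts of circle \<open>i\<close> with
  different neighbours apart; it is what makes gluing transitive and prevents triple points.\<close>

locale glue_data =
  fixes k :: nat and l :: "nat \<Rightarrow> real" and E :: "(nat \<times> nat) set" and z :: "nat \<Rightarrow> nat \<Rightarrow> real"
  assumes k: "2 \<le> k" and lpos: "\<And>i. i \<in> {1..k} \<Longrightarrow> 0 < l i"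
    and tree: "E \<in> tree_edges {1..k} 1"
    and z_range: "\<And>i j. (i, j) \<in> E \<Longrightarrow> z i j \<in> {0..<l i}"
    and z_inj: "\<And>i. inj_on (z i) (E `` {i})"
begin

abbreviation "R \<equiv> glue k l E z"

lemma E_subset: "E \<subseteq> {1..k} \<times> {1..k}" and sym_E: "sym E" and irrefl_E: "irrefl E"
  and card_E: "card E = 2 * (k - 1)"
  using tree_edges_basic[OF tree] k by auto

lemma finite_E: "finite E"
  using E_subset by (rule finite_subset) simp

lemma nbrs_nonempty: "i \<in> {1..k} \<Longrightarrow> E `` {i} \<noteq> {}"
  using tree_nbrs_nonempty[OF tree] k by simp

lemma z_eqD: "(i, j) \<in> E \<Longrightarrow> (i, j') \<in> E \<Longrightarrow> z i j = z i j' \<Longrightarrow> j = j'"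
  using z_inj[of i] by (auto dest: inj_onD)

lemma glue_iff: "((i, x), (j, y)) \<in> R \<longleftrightarrow>
    (i = j \<and> x = y \<and> i \<in> {1..k} \<and> x \<in> {0..<l i}) \<or> ((i, j) \<in> E \<and> x = z i j \<and> y = z j i)"
  by (auto simp: glue_def circle_points_def)

lemma not_loop: "(i, i) \<notin> E"
  using irrefl_E by (auto simp: irrefl_def)

lemma glue_gluing: "is_gluing k l R"
proof -
  have symE: "(j, i) \<in> E" if "(i, j) \<in> E" for i j using that sym_E by (auto dest: symD)
  have "equiv (circle_points k l) R"
  proof (rule equivI)
    show "R \<subseteq> circle_points k l \<times> circle_points k l"
      using E_subset z_range symE by (fastforce simp: glue_def circle_points_def)
    show "refl_on (circle_points k l) R"
      by (auto simp: refl_on_def glue_def)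
    show "sym R"
      using symE by (auto simp: sym_def glue_iff)
    show "trans R"
    proof (rule transI)
      fix p q r assume pq: "(p, q) \<in> R" and qr: "(q, r) \<in> R"
      obtain i x j y h w where [simp]: "p = (i, x)" "q = (j, y)" "r = (h, w)" by (cases p, cases q, cases r)
      show "(p, r) \<in> R"
      proof (cases "p = q \<or> q = r")
        \<comment> \<open>Both identifications are proper. The middle point belongs to only one
          contact of circle \<open>j\<close>, so the second identification undoes the first.\<close>
        case False
        then have "(i, j) \<in> E" "x = z i j" "y = z j i" "(j, h) \<in> E" "y = z j h" "w = z h j"
          using pq qr by (auto simp: glue_iff)
        moreover from this have "i = h" using z_eqD symE by metis
        ultimately show ?thesis using E_subset z_range by (auto simp: glue_iff)
      qed (use pq qr in auto)
    qed
  qed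
  moreover have "finite (R - Id)"
    by (rule finite_subset[of _ "(\<lambda>(i, j). ((i, z i j), (j, z j i))) ` E"]) (use finite_E in \<open>auto simp: glue_def\<close>)
  ultimately show ?thesis
    using not_loop by (auto simp: is_gluing_def glue_iff)
qed

lemma glue_generic: "no_triple_points R"
  unfolding no_triple_points_def
proof (rule allI)
  fix p :: point
  obtain i x where p: "p = (i, x)" by (cases p)
  have "\<exists>q. R `` {p} \<subseteq> {p, q}"
  proof (cases "\<exists>j. (i, j) \<in> E \<and> x = z i j")
    case True
    then obtain j where j: "(i, j) \<in> E" "x = z i j" by blast
    have "R `` {p} \<subseteq> {p, (j, z j i)}" using z_eqD[OF j(1)] j(2) by (auto simp: p glue_iff)
    then show ?thesis by blast
  next
    case False
    then have "R `` {p} \<subseteq> {p, p}" by (auto simp: p glue_iff)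
    then show ?thesis by blast
  qed
  then obtain q where "R `` {p} \<subseteq> {p, q}" by blast
  then have "card (R `` {p}) \<le> card {p, q}" by (intro card_mono) auto
  also have "\<dots> \<le> 2" by (simp add: card_insert_if)
  finally show "card (R `` {p}) \<le> 2" .
qed

lemma glue_params: "gluing_params R i = z i ` (E `` {i})"
proof (intro equalityI subsetI)
  fix x assume "x \<in> gluing_params R i"
  then obtain j y where "(j, y) \<noteq> (i, x)" "((i, x), (j, y)) \<in> R" by (auto simp: gluing_params_def)
  then show "x \<in> z i ` (E `` {i})" by (auto simp: glue_iff)
next
  fix x assume "x \<in> z i ` (E `` {i})"
  then obtain j where "(i, j) \<in> E" "x = z i j" by auto
  then show "x \<in> gluing_params R i"
    unfolding gluing_params_def mem_Collect_eq using not_loop by (intro exI[of _ "(j, z j i)"]) (auto simp: glue_iff)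
qed

lemma glue_contact: "contact R = E"
  using not_loop by (auto simp: contact_def glue_iff)

sublocale generic_gluing k l R
  using glue_gluing glue_generic glue_params nbrs_nonempty lpos by unfold_locales auto

lemma glue_cactus: "circle_cactus k l R"
proof (rule cactus_if_card_M)
  show "(i, j) \<in> (contact R)\<^sup>*" if "i \<in> {1..k}" "j \<in> {1..k}" for i j
  proof -
    have "(i, 1) \<in> E\<^sup>*" "(j, 1) \<in> E\<^sup>*" using tree_connected[OF tree] that by auto
    moreover have "sym (E\<^sup>*)" using sym_E by (rule sym_rtrancl)
    ultimately show ?thesis unfolding glue_contact by (meson rtrancl_trans symD)
  qed
  have "M = (\<lambda>(i, j). (i, z i j)) ` E"
    using E_subset by (force simp: glue_params)
  moreover have "inj_on (\<lambda>(i, j). (i, z i j)) E"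
    using z_eqD by (auto simp: inj_on_def)
  ultimately show "card M = 2 * (k - 1)" by (simp add: card_image card_E)
qed (rule k)

definition arc :: "nat \<Rightarrow> nat \<Rightarrow> real" where
  "arc i j = oriented_dist (l i) (z i j) (circle_succ (l i) (z i ` (E `` {i})) (z i j))"

lemma glue_next_param: "i \<in> {1..k} \<Longrightarrow> next_param l R i x = circle_succ (l i) (z i ` (E `` {i})) x"
  by (simp add: next_param_eq vertex_params_eq glue_params)

lemma glue_comb_type:
  "comb_type l R = {(i, j, j'). (i, j) \<in> E \<and> (i, j') \<in> E \<and> z i j' = circle_succ (l i) (z i ` (E `` {i})) (z i j)}"
proof -
  have "(i, j, j') \<in> comb_type l R \<longleftrightarrow> (i, j) \<in> E \<and> (i, j') \<in> E \<and> z i j' = next_param l R i (z i j)" for i j j'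
  proof
    assume "(i, j, j') \<in> comb_type l R"
    then show "(i, j) \<in> E \<and> (i, j') \<in> E \<and> z i j' = next_param l R i (z i j)"
      by (auto simp: comb_type_def glue_iff)
  next
    assume "(i, j) \<in> E \<and> (i, j') \<in> E \<and> z i j' = next_param l R i (z i j)"
    then have "((i, z i j), (j, z j i)) \<in> R" "((i, next_param l R i (z i j)), (j', z j' i)) \<in> R" "i \<noteq> j" "i \<noteq> j'"
      using not_loop by (auto simp: glue_iff)
    then show "(i, j, j') \<in> comb_type l R" unfolding comb_type_def by blast
  qed
  moreover have "i \<in> {1..k}" if "(i, j) \<in> E" for i j using E_subset that by auto
  ultimately show ?thesis using glue_next_param by auto
qed

lemma circle_succ_nbr:
  assumes "(i, j) \<in> E"
  obtains j' where "(i, j') \<in> E" "circle_succ (l i) (z i ` (E `` {i})) (z i j) = z i j'"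
proof -
  have "circle_succ (l i) (z i ` (E `` {i})) (z i j) \<in> z i ` (E `` {i})"
    using assms finite_E by (intro circle_succ_in) auto
  then show ?thesis using that by auto
qed

lemma glue_type_arcs: "type_arcs (comb_type l R) = E"
proof -
  have "\<exists>j'. (i, j') \<in> E \<and> z i j' = circle_succ (l i) (z i ` (E `` {i})) (z i j)" if "(i, j) \<in> E" for i j
    using circle_succ_nbr[OF that] by metis
  then show ?thesis unfolding type_arcs_def glue_comb_type by auto
qed

lemma glue_contact_param: "(i, j) \<in> E \<Longrightarrow> contact_param R i j = z i j"
  unfolding contact_param_def using not_loop by (intro the_equality) (auto simp: glue_iff)

lemma glue_arc_length: "(i, j) \<in> E \<Longrightarrow> arc_length l R i (contact_param R i j) = arc i j"
  using E_subset by (auto simp: glue_contact_param arc_length_def glue_next_param arc_def)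

lemma arc_coords_glue:
  "arc_coords l om R = (\<lambda>(i, j)\<in>{(i, j) \<in> E. j \<noteq> om (comb_type l R) i}. arc i j)"
  unfolding arc_coords_def coord_arcs_def glue_type_arcs
  by (rule restrict_ext) (auto simp: glue_arc_length)

lemma arc_pos: "(i, j) \<in> E \<Longrightarrow> 0 < arc i j"
proof -
  assume ij: "(i, j) \<in> E"
  obtain j' where j': "(i, j') \<in> E" "circle_succ (l i) (z i ` (E `` {i})) (z i j) = z i j'"
    using circle_succ_nbr[OF ij] by blast
  show "0 < arc i j"
    unfolding arc_def j'(2) using z_range[OF ij] z_range[OF j'(1)] by (auto simp: oriented_dist_def)
qed

text \<open>Reading the neighbours of \<open>i\<close> along its orientation, starting at
  \<open>b\<close>, turns the geometric successor relation into a list, the form in which types are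
  counted.\<close>

lemma circle_cyclic_order:
  assumes i: "i \<in> {1..k}" and b: "(i, b) \<in> E"
  obtains ps where "distinct (b # ps)" "set (b # ps) = E `` {i}"
    "\<And>j j'. (j, j') \<in> cyclic_pairs (b # ps) \<longleftrightarrow> (i, j, j') \<in> comb_type l R"
    "(\<Sum>j\<in>E `` {i}. arc i j) = l i"
proof -
  have "z i ` (E `` {i}) \<subseteq> {0..<l i}" using z_range by auto
  moreover have "finite (E `` {i})" using finite_E by (rule finite_Image)
  ultimately obtain ps D where ps: "distinct (b # ps)" "set (b # ps) = E `` {i}" "sorted_wrt (<) (map D (b # ps))"
      "\<And>j. j \<in> E `` {i} \<Longrightarrow> D j \<in> {0..<l i}" "\<And>j. j \<in> E `` {i} \<Longrightarrow> z i j = (z i b + D j) rmod l i"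
    using circle_positions_sorted[OF lpos[OF i] _ z_inj, of i b] b by auto
  have "\<forall>j\<in>set (b # ps). D j \<in> {0..<l i}" "\<forall>j\<in>set (b # ps). z i j = (z i b + D j) rmod l i"
    unfolding ps(2) using ps(4,5) by blast+
  note ctx = lpos[OF i] ps(3) this
  show ?thesis
  proof (rule that[OF ps(1,2)])
    show "(j, j') \<in> cyclic_pairs (b # ps) \<longleftrightarrow> (i, j, j') \<in> comb_type l R" for j j'
      unfolding circle_succ_iff_cyclic_pairs[OF ctx] ps(2) glue_comb_type by auto
    show "(\<Sum>j\<in>E `` {i}. arc i j) = l i"
      using sum_arcs[OF ctx] unfolding ps(2) arc_def by simp
  qed
qed

end

text \<open>\<open>M\<close> has at most \<open>2 * (k - 1)\<close> elements and is mapped onto at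
  least the contact pairs. These form a connected relation with at most as many pairs, hence a tree
  with exactly \<open>2 * (k - 1)\<close>. So the map is injective: touching circles share a single
  point, \<open>contact_param\<close> is well defined, and \<open>R\<close> is recovered from
  it.\<close>

lemma cactus_eq_glue:
  assumes k: "2 \<le> k" and lpos: "\<And>i. i \<in> {1..k} \<Longrightarrow> 0 < l i"
    and R: "circle_cactus k l R" "no_triple_points R"
  shows "glue_data k l (contact R) (contact_param R)" "R = glue k l (contact R) (contact_param R)"
proof -
  have gl: "is_gluing k l R" and cons: "circle_constellation k l R"
    using R(1) by (auto simp: circle_cactus_def circle_constellation_def)
  have conn: "(i, j) \<in> (contact R)\<^sup>*" if "i \<in> {1..k}" "j \<in> {1..k}" for i j
    using constellation_contact_connected[OF gl lpos cons that] .
  \<comment> \<open>As \<open>k\<close> is at least 2, there is another circle, and the walk towards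
    it leaves circle \<open>i\<close> through a contact.\<close>
  have nonempty: "gluing_params R i \<noteq> {}" if i: "i \<in> {1..k}" for i
  proof -
    obtain j where j: "j \<in> {1..k}" "j \<noteq> i"
      using k i by (metis One_nat_def atLeastAtMost_iff le_refl nat_le_linear numeral_2_eq_2 not_less_eq_eq)
    then obtain m where "(i, m) \<in> contact R" using conn[OF i j(1)] by (auto elim: converse_rtranclE)
    then obtain x y where "((i, x), (m, y)) \<in> R" "i \<noteq> m" by (auto simp: contact_def)
    then have "x \<in> gluing_params R i"
      unfolding gluing_params_def mem_Collect_eq by (intro exI[of _ "(m, y)"]) auto
    then show ?thesis by auto
  qed
  interpret generic_gluing k l R
    using gl R(2) nonempty lpos by unfold_locales
  let ?f = "\<lambda>p. (fst p, fst (partner p))"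
  have M_le: "card M \<le> 2 * (k - 1)" using cactus_card_M_le[OF R(1)] k by simp
  have tree: "contact R \<in> tree_edges {1..k} 1"
  proof (rule tree_edgesI)
    show "card (contact R) \<le> 2 * (card {1..k} - 1)" using card_contact_le M_le by simp
    show "(v, 1) \<in> (contact R)\<^sup>*" if "v \<in> {1..k}" for v using conn[OF that] k by simp
  qed (use k contact_subset[OF gl] sym_contact[OF gl] irrefl_contact[OF gl] in auto)
  have "card M \<le> card (contact R)" using M_le tree_edges_basic(4)[OF tree] k by simp
  also have "\<dots> \<le> card (?f ` M)"
    using contact_subset_image finite_M by (intro card_mono) auto
  finally have inj: "inj_on ?f M"
    using finite_M card_image_le[OF finite_M, of ?f] by (intro eq_card_imp_inj_on) auto
  have unique: "x = x'" if "((i, x), (j, y)) \<in> R" "((i, x'), (j, y')) \<in> R" "i \<noteq> j" for i j x x' y y'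
    using inj_onD[OF inj, of "(i, x)" "(i, x')"] partner_eq[OF that(1,3)] partner_eq[OF that(2,3)] by simp
  have param: "contact_param R i j = x" if "((i, x), (j, y)) \<in> R" "i \<noteq> j" for i j x y
    unfolding contact_param_def using that unique by (intro the_equality) blast+
  have rng: "contact_param R i j \<in> {0..<l i}" if ij: "(i, j) \<in> contact R" for i j
  proof -
    obtain x y where xy: "((i, x), (j, y)) \<in> R" "i \<noteq> j" using ij by (auto simp: contact_def)
    then show ?thesis using param[OF xy] gluing_in_points[OF gl xy(1)] by (simp add: circle_points_def)
  qed
  have injz: "inj_on (contact_param R i) (contact R `` {i})" for i
  proof (rule inj_onI)
    fix j j' assume j: "j \<in> contact R `` {i}" "j' \<in> contact R `` {i}" "contact_param R i j = contact_param R i j'"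
    obtain x y where xy: "((i, x), (j, y)) \<in> R" "i \<noteq> j" using j(1) by (auto simp: contact_def)
    obtain x' y' where xy': "((i, x'), (j', y')) \<in> R" "i \<noteq> j'" using j(2) by (auto simp: contact_def)
    have "x = x'" using param[OF xy] param[OF xy'] j(3) by simp
    then show "j = j'" using partner_eq[OF xy] partner_eq[OF xy'] by simp
  qed
  show gd: "glue_data k l (contact R) (contact_param R)"
    using k lpos tree rng injz by unfold_locales auto
  interpret g: glue_data k l "contact R" "contact_param R" by (rule gd)
  have "((i, x), (j, y)) \<in> R \<longleftrightarrow> ((i, x), (j, y)) \<in> glue k l (contact R) (contact_param R)" for i x j y
  proof
    assume xy: "((i, x), (j, y)) \<in> R"
    show "((i, x), (j, y)) \<in> glue k l (contact R) (contact_param R)"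
    proof (cases "i = j")
      case True
      then show ?thesis using xy gluing_same_circle[OF gl] gluing_in_points[OF gl xy]
        by (auto simp: g.glue_iff circle_points_def)
    next
      case False
      then have "(i, j) \<in> contact R" using xy by (auto simp: contact_def)
      then show ?thesis
        using False param[OF xy] param[OF gluing_sym[OF gl xy]] by (simp add: g.glue_iff)
    qed
  next
    assume "((i, x), (j, y)) \<in> glue k l (contact R) (contact_param R)"
    then consider "i = j" "x = y" "i \<in> {1..k}" "x \<in> {0..<l i}"
      | "(i, j) \<in> contact R" "x = contact_param R i j" "y = contact_param R j i"
      by (auto simp: g.glue_iff)
    then show "((i, x), (j, y)) \<in> R"
    proof cases
      case 1
      then have "(i, x) \<in> circle_points k l" by (simp add: circle_points_def)
      then show ?thesis using self_class[OF gl] 1 by auto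
    next
      case 2
      then obtain s t where st: "((i, s), (j, t)) \<in> R" "i \<noteq> j" by (auto simp: contact_def)
      then show ?thesis using 2 param[OF st] param[OF gluing_sym[OF gl st(1)]] by simp
    qed
  qed
  then show "R = glue k l (contact R) (contact_param R)" by (auto simp: set_eq_iff)
qed

section \<open>Combinatorial types\<close>

lemma rotate_rotate: "rotate_circles l \<theta>' (rotate_circles l \<theta> p) = rotate_circles l (\<lambda>i. \<theta> i + \<theta>' i) p"
proof (cases p)
  case (Pair i x)
  have "((x + \<theta> i) rmod l i + \<theta>' i) rmod l i = (x + \<theta> i + \<theta>' i) rmod l i"
    by (metis rmod_add rmod_rmod)
  then show ?thesis by (simp add: Pair rotate_circles_def add.assoc)
qed

lemma rotate_0: "p \<in> circle_points k l \<Longrightarrow> rotate_circles l (\<lambda>_. 0) p = p"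
  by (auto simp: rotate_circles_def circle_points_def)

definition rotate_gluing :: "(nat \<Rightarrow> real) \<Rightarrow> (nat \<Rightarrow> real) \<Rightarrow> gluing \<Rightarrow> gluing" where
  "rotate_gluing l \<theta> R = map_prod (rotate_circles l \<theta>) (rotate_circles l \<theta>) ` R"

lemma rotate_gluing_rotate: "rotate_gluing l \<theta>' (rotate_gluing l \<theta> R) = rotate_gluing l (\<lambda>i. \<theta> i + \<theta>' i) R"
  unfolding rotate_gluing_def image_image map_prod_def
  by (intro image_cong refl) (auto simp: rotate_rotate)

lemma rotate_gluing_0:
  assumes "R \<subseteq> circle_points k l \<times> circle_points k l"
  shows "rotate_gluing l (\<lambda>_. 0) R = R"
proof -
  have "map_prod (rotate_circles l (\<lambda>_. 0)) (rotate_circles l (\<lambda>_. 0)) p = p" if "p \<in> R" for p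
    using that assms rotate_0 by (cases p) auto
  then show ?thesis unfolding rotate_gluing_def by simp
qed

lemma cactus_iso_iff: "(R, R') \<in> cactus_iso k l \<longleftrightarrow>
    circle_cactus k l R \<and> circle_cactus k l R' \<and> (\<exists>\<theta>. R' = rotate_gluing l \<theta> R)"
  by (simp add: cactus_iso_def rotate_gluing_def)

lemma equiv_cactus_iso: "equiv {R. circle_cactus k l R} (cactus_iso k l)"
proof (rule equivI)
  have sub: "R \<subseteq> circle_points k l \<times> circle_points k l" if "circle_cactus k l R" for R
    using that gluing_equiv[of k l R] by (auto simp: circle_cactus_def circle_constellation_def equiv_def)
  show "cactus_iso k l \<subseteq> {R. circle_cactus k l R} \<times> {R. circle_cactus k l R}"
    by (auto simp: cactus_iso_def)
  show "refl_on {R. circle_cactus k l R} (cactus_iso k l)"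
    using rotate_gluing_0[OF sub] by (auto simp: refl_on_def cactus_iso_iff intro!: exI[of _ "\<lambda>_. 0"])
  show "sym (cactus_iso k l)"
  proof (rule symI)
    fix R R' assume R: "(R, R') \<in> cactus_iso k l"
    then obtain \<theta> where "R' = rotate_gluing l \<theta> R" by (auto simp: cactus_iso_iff)
    then have "R = rotate_gluing l (\<lambda>i. - \<theta> i) R'"
      using rotate_gluing_0[OF sub] R by (simp add: rotate_gluing_rotate cactus_iso_iff)
    with R show "(R', R) \<in> cactus_iso k l" by (auto simp: cactus_iso_iff)
  qed
  show "trans (cactus_iso k l)"
    by (auto simp: trans_def cactus_iso_iff rotate_gluing_rotate)
qed

lemma rotate_circle_points:
  assumes "\<And>i. i \<in> {1..k} \<Longrightarrow> 0 < l i"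
  shows "rotate_circles l \<theta> ` circle_points k l = circle_points k l"
proof -
  have into: "rotate_circles l \<theta> p \<in> circle_points k l" if "p \<in> circle_points k l" for \<theta> p
    using that assms by (auto simp: rotate_circles_def circle_points_def rmod_less intro!: rmod_nonneg)
  have "p = rotate_circles l \<theta> (rotate_circles l (\<lambda>i. - \<theta> i) p)" if "p \<in> circle_points k l" for p
    using rotate_0[OF that] by (simp add: rotate_rotate)
  then show ?thesis using into by blast
qed

lemma glue_rotate:
  assumes "glue_data k l E z" and z': "\<And>i j. (i, j) \<in> E \<Longrightarrow> z' i j = (z i j + \<theta> i) rmod l i"
  shows "glue k l E z' = rotate_gluing l \<theta> (glue k l E z)"
proof -
  interpret glue_data k l E z by fact
  have pts: "rotate_circles l \<theta> ` circle_points k l = circle_points k l"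
    using lpos by (rule rotate_circle_points)
  have "map_prod (rotate_circles l \<theta>) (rotate_circles l \<theta>) ` Id_on (circle_points k l) = Id_on (rotate_circles l \<theta> ` circle_points k l)"
  proof -
    have "Id_on A = (\<lambda>p. (p, p)) ` A" for A :: "point set" by auto
    then show ?thesis by (simp add: image_image)
  qed
  moreover have "map_prod (rotate_circles l \<theta>) (rotate_circles l \<theta>) ` (\<lambda>(i, j). ((i, z i j), (j, z j i))) ` E
      = (\<lambda>(i, j). ((i, z' i j), (j, z' j i))) ` E"
    unfolding image_image using z' sym_E by (intro image_cong) (auto simp: rotate_circles_def dest: symD)
  ultimately show ?thesis
    unfolding rotate_gluing_def glue_def image_Un by (simp add: pts)
qed

text \<open>The common type lists the neighbours of each circle in the same cyclic order for
  \<open>z\<close> and \<open>z'\<close>, so equal arcs make the two families of positions differ by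
  a rotation of each circle. The angles for different circles are chosen independently.\<close>

lemma equal_arcs_imp_iso:
  assumes gd: "glue_data k l E z" "glue_data k l E z'"
    and type: "comb_type l (glue k l E z) = comb_type l (glue k l E z')"
    and arcs: "\<And>i j. (i, j) \<in> E \<Longrightarrow> glue_data.arc l E z i j = glue_data.arc l E z' i j"
  shows "(glue k l E z, glue k l E z') \<in> cactus_iso k l"
proof -
  interpret a: glue_data k l E z by fact
  interpret b: glue_data k l E z' by fact
  have "\<exists>\<theta>. \<forall>j\<in>E `` {i}. z' i j = (z i j + \<theta>) rmod l i" if i: "i \<in> {1..k}" for i
  proof -
    obtain c where c: "(i, c) \<in> E" using a.nbrs_nonempty[OF i] by auto
    obtain ps where ps: "distinct (c # ps)" "set (c # ps) = E `` {i}"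
      "\<And>j j'. (j, j') \<in> cyclic_pairs (c # ps) \<longleftrightarrow> (i, j, j') \<in> comb_type l (glue k l E z)"
      using a.circle_cyclic_order[OF i c] by metis
    define xs where "xs = c # ps"
    note ps = ps[folded xs_def]
    have "\<exists>\<theta>. \<forall>j\<in>set xs. z' i j = (z i j + \<theta>) rmod l i"
    proof (rule equal_arcs_rotation[OF a.lpos[OF i]])
      show "z i ` set xs \<subseteq> {0..<l i}" "z' i ` set xs \<subseteq> {0..<l i}"
        unfolding ps(2) using a.z_range b.z_range by auto
      fix n assume n: "Suc n < length xs"
      then have "(xs ! n, xs ! Suc n) \<in> cyclic_pairs xs"
        using cyclic_pairs_nth[OF ps(1), of n] by simp
      then have t: "(i, xs ! n, xs ! Suc n) \<in> comb_type l (glue k l E z)" using ps(3) by blast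
      moreover have "(i, xs ! n, xs ! Suc n) \<in> comb_type l (glue k l E z')" using t type by simp
      ultimately show "oriented_dist (l i) (z i (xs ! n)) (z i (xs ! Suc n)) = oriented_dist (l i) (z' i (xs ! n)) (z' i (xs ! Suc n))"
        using arcs[of i "xs ! n"] unfolding a.glue_comb_type b.glue_comb_type a.arc_def b.arc_def by auto
    qed
    then show ?thesis unfolding ps(2) .
  qed
  then obtain \<theta> where \<theta>: "\<And>i j. i \<in> {1..k} \<Longrightarrow> (i, j) \<in> E \<Longrightarrow> z' i j = (z i j + \<theta> i) rmod l i"
    by (metis Image_singleton_iff)
  have "glue k l E z' = rotate_gluing l \<theta> (glue k l E z)"
    using gd(1) \<theta> a.E_subset by (intro glue_rotate) auto
  then show ?thesis using a.glue_cactus b.glue_cactus by (auto simp: cactus_iso_iff)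
qed

text \<open>A cyclic order of the neighbours of circle \<open>i\<close> is written as a list starting at a chosen
  neighbour \<open>base E i\<close>, which makes the list unique.\<close>

definition base :: "(nat \<times> nat) set \<Rightarrow> nat \<Rightarrow> nat" where
  "base E i = (SOME j. (i, j) \<in> E)"

definition orders :: "nat \<Rightarrow> (nat \<times> nat) set \<Rightarrow> (nat \<Rightarrow> nat list) set" where
  "orders k E = (\<Pi>\<^sub>E i\<in>{1..k}. permutations_of_set (E `` {i} - {base E i}))"

definition cyclic_type :: "nat \<Rightarrow> (nat \<times> nat) set \<Rightarrow> (nat \<Rightarrow> nat list) \<Rightarrow> comb_type" where
  "cyclic_type k E f = {(i, j, j'). i \<in> {1..k} \<and> (j, j') \<in> cyclic_pairs (base E i # f i)}"

context
  fixes k :: nat and E :: "(nat \<times> nat) set"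
  assumes k: "2 \<le> k" and tree: "E \<in> tree_edges {1..k} 1"
begin

lemma base_nbr: "i \<in> {1..k} \<Longrightarrow> (i, base E i) \<in> E"
  using tree_nbrs_nonempty[OF tree, of i] k unfolding base_def by (auto intro: someI_ex)

lemma orders_list:
  assumes "f \<in> orders k E" "i \<in> {1..k}"
  shows "distinct (base E i # f i)" "set (base E i # f i) = E `` {i}"
proof -
  have "f i \<in> permutations_of_set (E `` {i} - {base E i})"
    using assms by (auto simp: orders_def)
  then have "set (f i) = E `` {i} - {base E i}" "distinct (f i)" by (auto simp: permutations_of_set_def)
  with base_nbr[OF assms(2)] show "distinct (base E i # f i)" "set (base E i # f i) = E `` {i}" by auto
qed

lemma type_arcs_cyclic_type:
  assumes "f \<in> orders k E"
  shows "type_arcs (cyclic_type k E f) = E"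
proof -
  have "(i, j) \<in> type_arcs (cyclic_type k E f) \<longleftrightarrow> i \<in> {1..k} \<and> j \<in> Domain (cyclic_pairs (base E i # f i))" for i j
    by (auto simp: type_arcs_def cyclic_type_def)
  then have "(i, j) \<in> type_arcs (cyclic_type k E f) \<longleftrightarrow> i \<in> {1..k} \<and> (i, j) \<in> E" for i j
    unfolding Domain_cyclic_pairs using orders_list(2)[OF assms, of i] by blast
  moreover have "i \<in> {1..k}" if "(i, j) \<in> E" for i j
    using that tree_edges_basic(1)[OF tree] k by auto
  ultimately have "(i, j) \<in> type_arcs (cyclic_type k E f) \<longleftrightarrow> (i, j) \<in> E" for i j by blast
  then show ?thesis by auto
qed

lemma card_orders: "card (orders k E) = (\<Prod>i\<in>{1..k}. fact (card (E `` {i}) - 1))"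
proof -
  have "finite E" using tree_edges_basic(1)[OF tree] k by (auto intro: finite_subset)
  then have "card (permutations_of_set (E `` {i} - {base E i})) = fact (card (E `` {i}) - 1)" if "i \<in> {1..k}" for i
    using base_nbr[OF that] by (subst card_permutations_of_set) (auto simp: card_Diff_singleton)
  then show ?thesis unfolding orders_def by (simp add: card_PiE)
qed

end

lemma finite_orders: "finite (orders k E)"
  unfolding orders_def by (intro finite_PiE) auto

lemma finite_tree_edges: "finite V \<Longrightarrow> finite (tree_edges V r)"
  unfolding tree_edges_def by (intro finite_imageI finite_forests) auto

lemma (in glue_data) comb_type_cyclic: "\<exists>f\<in>orders k E. comb_type l R = cyclic_type k E f"
proof -
  have "\<exists>ps. ps \<in> permutations_of_set (E `` {i} - {base E i}) \<and>
      (\<forall>j j'. (j, j') \<in> cyclic_pairs (base E i # ps) \<longleftrightarrow> (i, j, j') \<in> comb_type l R)" if i: "i \<in> {1..k}" for i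
  proof -
    obtain ps where ps: "distinct (base E i # ps)" "set (base E i # ps) = E `` {i}"
      "\<And>j j'. (j, j') \<in> cyclic_pairs (base E i # ps) \<longleftrightarrow> (i, j, j') \<in> comb_type l R"
      using circle_cyclic_order[OF i base_nbr[OF k tree i]] by metis
    then have "ps \<in> permutations_of_set (E `` {i} - {base E i})" by (auto simp: permutations_of_set_def)
    with ps(3) show ?thesis by blast
  qed
  then obtain f where f: "\<And>i. i \<in> {1..k} \<Longrightarrow> f i \<in> permutations_of_set (E `` {i} - {base E i})"
      "\<And>i j j'. i \<in> {1..k} \<Longrightarrow> (j, j') \<in> cyclic_pairs (base E i # f i) \<longleftrightarrow> (i, j, j') \<in> comb_type l R"
    by metis
  have "i \<in> {1..k}" if "(i, j, j') \<in> comb_type l R" for i j j'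
    using that E_subset by (auto simp: glue_comb_type)
  then have "comb_type l R = cyclic_type k E (restrict f {1..k})"
    using f(2) by (auto simp: cyclic_type_def)
  moreover have "restrict f {1..k} \<in> orders k E" using f(1) by (auto simp: orders_def)
  ultimately show ?thesis by blast
qed

text \<open>Positions on different circles are subject to no common condition, so
  \<open>circle_realization\<close> can be applied to each circle separately and the results glued
  along the tree.\<close>

lemma glue_realization:
  assumes k: "2 \<le> k" and tree: "E \<in> tree_edges {1..k} 1" and f: "f \<in> orders k E"
    and lpos: "\<And>i. i \<in> {1..k} \<Longrightarrow> 0 < l i"
    and a: "\<And>i j. (i, j) \<in> E \<Longrightarrow> 0 < a i j" "\<And>i. i \<in> {1..k} \<Longrightarrow> (\<Sum>j\<in>E `` {i}. a i j) = l i"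
  obtains z where "glue_data k l E z" "comb_type l (glue k l E z) = cyclic_type k E f"
    "\<And>i j. (i, j) \<in> E \<Longrightarrow> glue_data.arc l E z i j = a i j"
proof -
  let ?xs = "\<lambda>i. base E i # f i"
  have E: "E \<subseteq> {1..k} \<times> {1..k}" using tree_edges_basic(1)[OF tree] k by simp
  have "\<exists>y. inj_on y (E `` {i}) \<and> y ` (E `` {i}) \<subseteq> {0..<l i} \<and>
    (\<forall>j j'. (j, j') \<in> cyclic_pairs (?xs i) \<longleftrightarrow> (i, j) \<in> E \<and> (i, j') \<in> E \<and> y j' = circle_succ (l i) (y ` (E `` {i})) (y j)) \<and>
    (\<forall>j. (i, j) \<in> E \<longrightarrow> oriented_dist (l i) (y j) (circle_succ (l i) (y ` (E `` {i})) (y j)) = a i j)"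
    if i: "i \<in> {1..k}" for i
  proof -
    note xs = orders_list[OF k tree f i]
    obtain y where y: "inj_on y (set (?xs i))" "y ` set (?xs i) \<subseteq> {0..<l i}"
      "\<And>j j'. (j, j') \<in> cyclic_pairs (?xs i) \<longleftrightarrow> j \<in> set (?xs i) \<and> j' \<in> set (?xs i) \<and> y j' = circle_succ (l i) (y ` set (?xs i)) (y j)"
      "\<And>j. j \<in> set (?xs i) \<Longrightarrow> oriented_dist (l i) (y j) (circle_succ (l i) (y ` set (?xs i)) (y j)) = a i j"
      using circle_realization[OF xs(1), of "a i" "l i"] a i unfolding xs(2) by auto
    show ?thesis using y unfolding xs(2) Image_singleton_iff by blast
  qed
  then have "\<forall>i. \<exists>y. i \<in> {1..k} \<longrightarrow> inj_on y (E `` {i}) \<and> y ` (E `` {i}) \<subseteq> {0..<l i} \<and>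
    (\<forall>j j'. (j, j') \<in> cyclic_pairs (?xs i) \<longleftrightarrow> (i, j) \<in> E \<and> (i, j') \<in> E \<and> y j' = circle_succ (l i) (y ` (E `` {i})) (y j)) \<and>
    (\<forall>j. (i, j) \<in> E \<longrightarrow> oriented_dist (l i) (y j) (circle_succ (l i) (y ` (E `` {i})) (y j)) = a i j)"
    by blast
  then obtain z where z: "\<And>i. i \<in> {1..k} \<Longrightarrow> inj_on (z i) (E `` {i}) \<and> z i ` (E `` {i}) \<subseteq> {0..<l i} \<and>
    (\<forall>j j'. (j, j') \<in> cyclic_pairs (?xs i) \<longleftrightarrow> (i, j) \<in> E \<and> (i, j') \<in> E \<and> z i j' = circle_succ (l i) (z i ` (E `` {i})) (z i j)) \<and>
    (\<forall>j. (i, j) \<in> E \<longrightarrow> oriented_dist (l i) (z i j) (circle_succ (l i) (z i ` (E `` {i})) (z i j)) = a i j)"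
    by (drule_tac choice) blast
  have "inj_on (z i) (E `` {i})" for i
  proof (cases "i \<in> {1..k}")
    case False
    then have "E `` {i} = {}" using E by auto
    then show ?thesis by simp
  qed (use z in blast)
  moreover have "z i j \<in> {0..<l i}" if ij: "(i, j) \<in> E" for i j
  proof -
    have "i \<in> {1..k}" using ij E by auto
    then have "z i ` (E `` {i}) \<subseteq> {0..<l i}" using z by blast
    then show ?thesis using ij by auto
  qed
  ultimately have gd: "glue_data k l E z"
    using k lpos tree by unfold_locales auto
  interpret glue_data k l E z by (rule gd)
  show ?thesis
  proof (rule that[OF gd])
    have "(i, j, j') \<in> comb_type l (glue k l E z) \<longleftrightarrow> (i, j, j') \<in> cyclic_type k E f" for i j j'
    proof (cases "i \<in> {1..k}")
      case True
      then show ?thesis using z[OF True] by (auto simp: glue_comb_type cyclic_type_def)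
    next
      case False
      then show ?thesis using E by (auto simp: glue_comb_type cyclic_type_def)
    qed
    then show "comb_type l (glue k l E z) = cyclic_type k E f" by auto
    show "arc i j = a i j" if ij: "(i, j) \<in> E" for i j
    proof -
      have "i \<in> {1..k}" using ij E by auto
      then show ?thesis using z ij unfolding arc_def by blast
    qed
  qed
qed

text \<open>The tree is recovered as the set of arcs of the type. It determines the base neighbours,
  and these make the lists unique.\<close>

lemma cyclic_type_inj:
  assumes "2 \<le> k"
  shows "inj_on (\<lambda>(E, f). cyclic_type k E f) (SIGMA E:tree_edges {1..k} 1. orders k E)"
proof (rule inj_onI, clarify)
  fix E f E' f'
  assume E: "E \<in> tree_edges {1..k} 1" "f \<in> orders k E" and E': "E' \<in> tree_edges {1..k} 1" "f' \<in> orders k E'"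
    and eq: "cyclic_type k E f = cyclic_type k E' f'"
  have [simp]: "E' = E"
    using type_arcs_cyclic_type[OF assms E] type_arcs_cyclic_type[OF assms E'] eq by simp
  have "f i = f' i" if i: "i \<in> {1..k}" for i
  proof (rule cyclic_pairs_inj)
    show "distinct (base E i # f i)" "distinct (base E i # f' i)"
      using orders_list(1)[OF assms E i] orders_list(1)[OF assms E' i] by simp_all
    have "(j, j') \<in> cyclic_pairs (base E i # f i) \<longleftrightarrow> (i, j, j') \<in> cyclic_type k E f" for j j'
      using i by (simp add: cyclic_type_def)
    moreover have "(j, j') \<in> cyclic_pairs (base E i # f' i) \<longleftrightarrow> (i, j, j') \<in> cyclic_type k E' f'" for j j'
      using i by (simp add: cyclic_type_def)
    ultimately show "cyclic_pairs (base E i # f i) = cyclic_pairs (base E i # f' i)"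
      using eq by auto
  qed
  moreover have "f \<in> orders k E" "f' \<in> orders k E" using E E' by auto
  ultimately show "E = E' \<and> f = f'" unfolding orders_def by (auto intro: PiE_ext)
qed

lemma generic_types_eq:
  assumes k: "2 \<le> k" and lpos: "\<And>i. i \<in> {1..k} \<Longrightarrow> 0 < l i"
  shows "generic_types k l = (\<lambda>(E, f). cyclic_type k E f) ` (SIGMA E:tree_edges {1..k} 1. orders k E)"
proof (intro equalityI subsetI)
  fix t assume "t \<in> generic_types k l"
  then obtain R where R: "circle_cactus k l R" "no_triple_points R" "t = comb_type l R"
    by (auto simp: generic_types_def)
  interpret glue_data k l "contact R" "contact_param R" by (rule cactus_eq_glue(1)[OF k lpos R(1,2)])
  show "t \<in> (\<lambda>(E, f). cyclic_type k E f) ` (SIGMA E:tree_edges {1..k} 1. orders k E)"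
    using comb_type_cyclic tree R(3) cactus_eq_glue(2)[OF k lpos R(1,2)] by force
next
  fix t assume "t \<in> (\<lambda>(E, f). cyclic_type k E f) ` (SIGMA E:tree_edges {1..k} 1. orders k E)"
  then obtain E f where E: "E \<in> tree_edges {1..k} 1" "f \<in> orders k E" "t = cyclic_type k E f" by auto
  \<comment> \<open>Any positive lengths with the right sums would do as a witness for the type;
    here each circle is cut into equal arcs.\<close>
  define a where "a i j = l i / real (card (E `` {i}))" for i j :: nat
  have fin: "finite E" using tree_edges_basic(1)[OF E(1)] k by (auto intro: finite_subset)
  have deg: "0 < card (E `` {i})" if "i \<in> {1..k}" for i
    using base_nbr[OF k E(1) that] fin by (auto simp: card_gt_0_iff)
  have "0 < a i j" if "(i, j) \<in> E" for i j
  proof -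
    have "i \<in> {1..k}" using that tree_edges_basic(1)[OF E(1)] k by auto
    then show ?thesis using deg lpos by (simp add: a_def)
  qed
  moreover have "(\<Sum>j\<in>E `` {i}. a i j) = l i" if "i \<in> {1..k}" for i
    using deg[OF that] by (simp add: a_def)
  ultimately obtain z where z: "glue_data k l E z" "comb_type l (glue k l E z) = cyclic_type k E f"
    using glue_realization[OF k E(1,2), of l a] lpos by metis
  interpret glue_data k l E z by (rule z(1))
  show "t \<in> generic_types k l"
    unfolding generic_types_def using glue_cactus glue_generic z(2) E(3) by auto
qed

section \<open>The volume of the space of cacti\<close>

lemma Union_cactus_space: "\<Union>(cactus_space k l) = {R. circle_cactus k l R}"
  unfolding cactus_space_def using equiv_cactus_iso by (rule Union_quotient)

context
  fixes k :: nat and l :: "nat \<Rightarrow> real" and om :: "comb_type \<Rightarrow> nat \<Rightarrow> nat"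
  assumes k: "2 \<le> k" and lpos: "\<And>i. i \<in> {1..k} \<Longrightarrow> 0 < l i" and om: "arc_omission k l om"
begin

lemma generic_types_cyclic: "generic_types k l = (\<lambda>(E, f). cyclic_type k E f) ` (SIGMA E:tree_edges {1..k} 1. orders k E)"
  using k lpos by (rule generic_types_eq)

lemma om_nbr:
  assumes "t \<in> generic_types k l" "i \<in> {1..k}"
  shows "(i, om t i) \<in> type_arcs t"
  using om assms by (simp add: arc_omission_def)

text \<open>The type fixes the contact graph, and the length of the omitted arc is
  \<open>l i\<close> minus the other arcs of its circle. So all arcs agree, and the gluings differ
  by rotations.\<close>

lemma arc_coords_inj:
  assumes R: "circle_cactus k l R" "no_triple_points R" and R': "circle_cactus k l R'" "no_triple_points R'"
    and type: "comb_type l R = comb_type l R'" and coords: "arc_coords l om R = arc_coords l om R'"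
  shows "(R, R') \<in> cactus_iso k l"
proof -
  define E z z' t where "E = contact R" and "z = contact_param R" and "z' = contact_param R'" and "t = comb_type l R"
  note eq = cactus_eq_glue[OF k lpos R, folded E_def z_def]
  note eq' = cactus_eq_glue[OF k lpos R', folded z'_def]
  interpret a: glue_data k l E z by (rule eq(1))
  interpret c: glue_data k l "contact R'" z' by (rule eq'(1))
  have E: "contact R' = E"
    using a.glue_type_arcs c.glue_type_arcs type eq(2) eq'(2) by simp
  interpret b: glue_data k l E z' using eq'(1) unfolding E .
  have R_eq: "R = glue k l E z" and R'_eq: "R' = glue k l E z'"
    using eq(2) eq'(2) unfolding E by auto
  have t': "comb_type l (glue k l E z) = t" "comb_type l (glue k l E z') = t"
    using type R_eq R'_eq by (auto simp: t_def)
  have t_gen: "t \<in> generic_types k l" using R by (auto simp: generic_types_def t_def)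
  have rest: "a.arc i j = b.arc i j" if "(i, j) \<in> E" "j \<noteq> om t i" for i j
  proof -
    have "arc_coords l om R (i, j) = arc_coords l om R' (i, j)" using coords by simp
    then show ?thesis
      unfolding R_eq R'_eq a.arc_coords_glue b.arc_coords_glue t' using that by simp
  qed
  have "a.arc i j = b.arc i j" if ij: "(i, j) \<in> E" for i j
  proof (cases "j = om t i")
    case True
    have i: "i \<in> {1..k}" using ij a.E_subset by auto
    have fin: "finite (E `` {i})" using a.finite_E by (rule finite_Image)
    have "(\<Sum>m\<in>E `` {i}. a.arc i m) = l i" "(\<Sum>m\<in>E `` {i}. b.arc i m) = l i"
      using a.circle_cyclic_order[OF i ij] b.circle_cyclic_order[OF i ij] by metis+
    then have "a.arc i j + (\<Sum>m\<in>E `` {i} - {j}. a.arc i m) = b.arc i j + (\<Sum>m\<in>E `` {i} - {j}. b.arc i m)"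
      using fin ij by (simp add: sum.remove[of "E `` {i}" j])
    moreover have "(\<Sum>m\<in>E `` {i} - {j}. a.arc i m) = (\<Sum>m\<in>E `` {i} - {j}. b.arc i m)"
      using True by (intro sum.cong) (auto intro: rest)
    ultimately show ?thesis by simp
  qed (use rest ij in blast)
  then show ?thesis
    unfolding R_eq R'_eq using equal_arcs_imp_iso[OF eq(1) b.glue_data_axioms] t' by simp
qed

text \<open>The one constraint beyond positivity of the coordinates is that the omitted arc be
  positive; every point satisfying both is realized by some gluing of the tree.\<close>

lemma coord_image_space:
  assumes t: "t \<in> generic_types k l"
  shows "coord_image l om t (cactus_space k l) = arc_simplices {1..k} (coord_arcs om t) l"
proof -
  obtain E f where E: "E \<in> tree_edges {1..k} 1" "f \<in> orders k E" "t = cyclic_type k E f"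
    using t generic_types_cyclic by auto
  have type_arcs: "type_arcs t = E" using type_arcs_cyclic_type[OF k E(1,2)] E(3) by simp
  have coord_arcs: "coord_arcs om t = {(i, j) \<in> E. j \<noteq> om t i}"
    by (simp add: coord_arcs_def type_arcs)
  have nbrs: "coord_arcs om t `` {i} = E `` {i} - {om t i}" for i
    by (auto simp: coord_arcs)
  have om_in: "om t i \<in> E `` {i}" if "i \<in> {1..k}" for i using om_nbr[OF t that] type_arcs by simp
  have finE: "finite E" and E_sub: "E \<subseteq> {1..k} \<times> {1..k}"
    using tree_edges_basic(1)[OF E(1)] k by (auto intro: finite_subset)
  show ?thesis
  proof (intro equalityI subsetI)
    fix x assume "x \<in> coord_image l om t (cactus_space k l)"
    then obtain R where R: "circle_cactus k l R" "no_triple_points R" "comb_type l R = t" "x = arc_coords l om R"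
      unfolding coord_image_def Union_cactus_space by auto
    note eq = cactus_eq_glue[OF k lpos R(1,2)]
    interpret g: glue_data k l "contact R" "contact_param R" by (rule eq(1))
    have contact: "contact R = E" using g.glue_type_arcs type_arcs R(3) eq(2) by simp
    have x: "x = (\<lambda>(i, j)\<in>coord_arcs om t. g.arc i j)"
      using g.arc_coords_glue[of om] eq(2) R(3,4) unfolding coord_arcs contact by simp
    have "(\<Sum>j\<in>coord_arcs om t `` {i}. x (i, j)) < l i" if i: "i \<in> {1..k}" for i
    proof -
      have "(\<Sum>j\<in>coord_arcs om t `` {i}. x (i, j)) = (\<Sum>j\<in>E `` {i} - {om t i}. g.arc i j)"
        unfolding nbrs by (intro sum.cong) (auto simp: x coord_arcs)
      moreover have "(\<Sum>j\<in>E `` {i}. g.arc i j) = l i"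
        using g.circle_cyclic_order[OF i, of "om t i"] om_in[OF i] unfolding contact by auto
      moreover have "(\<Sum>j\<in>E `` {i}. g.arc i j) = g.arc i (om t i) + (\<Sum>j\<in>E `` {i} - {om t i}. g.arc i j)"
        using om_in[OF i] finE by (intro sum.remove) auto
      moreover have "0 < g.arc i (om t i)" using g.arc_pos om_in[OF i] contact by auto
      ultimately show ?thesis by linarith
    qed
    moreover have "0 < x e" if "e \<in> coord_arcs om t" for e
      using that g.arc_pos contact by (auto simp: x coord_arcs)
    moreover have "x \<in> extensional (coord_arcs om t)" by (simp add: x)
    ultimately show "x \<in> arc_simplices {1..k} (coord_arcs om t) l"
      by (simp add: arc_simplices_def)
  next
    fix x assume x: "x \<in> arc_simplices {1..k} (coord_arcs om t) l"
    \<comment> \<open>The omitted arc receives what the coordinates leave of \<open>l i\<close>,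
      which is positive inside the simplex.\<close>
    define a where "a i j = (if j = om t i then l i - (\<Sum>j\<in>E `` {i} - {om t i}. x (i, j)) else x (i, j))" for i j
    have a_pos: "0 < a i j" if ij: "(i, j) \<in> E" for i j
    proof -
      have "i \<in> {1..k}" using ij E_sub by auto
      then have "(\<Sum>j\<in>E `` {i} - {om t i}. x (i, j)) < l i"
        using x unfolding arc_simplices_def nbrs by auto
      moreover have "0 < x (i, j)" if "j \<noteq> om t i"
        using x ij that unfolding arc_simplices_def coord_arcs by auto
      ultimately show ?thesis by (simp add: a_def)
    qed
    have a_sum: "(\<Sum>j\<in>E `` {i}. a i j) = l i" if i: "i \<in> {1..k}" for i
    proof -
      have "(\<Sum>j\<in>E `` {i}. a i j) = a i (om t i) + (\<Sum>j\<in>E `` {i} - {om t i}. a i j)"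
        using om_in[OF i] finE by (intro sum.remove) auto
      also have "(\<Sum>j\<in>E `` {i} - {om t i}. a i j) = (\<Sum>j\<in>E `` {i} - {om t i}. x (i, j))"
        by (intro sum.cong) (auto simp: a_def)
      finally show ?thesis by (simp add: a_def)
    qed
    obtain z where z: "glue_data k l E z" "comb_type l (glue k l E z) = cyclic_type k E f"
      "\<And>i j. (i, j) \<in> E \<Longrightarrow> glue_data.arc l E z i j = a i j"
      using glue_realization[OF k E(1,2) lpos a_pos a_sum] by blast
    interpret g: glue_data k l E z by (rule z(1))
    have "arc_coords l om (glue k l E z) = (\<lambda>(i, j)\<in>coord_arcs om t. g.arc i j)"
      unfolding g.arc_coords_glue z(2) E(3)[symmetric] coord_arcs ..
    also have "\<dots> = x"
    proof (rule extensionalityI[of _ "coord_arcs om t"])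
      show "x \<in> extensional (coord_arcs om t)" using x by (simp add: arc_simplices_def)
    qed (auto simp: coord_arcs z(3) a_def)
    finally show "x \<in> coord_image l om t (cactus_space k l)"
      unfolding coord_image_def Union_cactus_space using g.glue_cactus g.glue_generic z(2) E(3) by force
  qed
qed

text \<open>Points of \<open>cactus_space\<close> are whole rotation classes, and type and
  coordinates determine the class. This injectivity makes images respect complements and disjoint
  unions, as a measure requires.\<close>

lemma cactus_space_disjoint:
  assumes "A \<subseteq> cactus_space k l" "B \<subseteq> cactus_space k l" "A \<inter> B = {}"
  shows "coord_image l om t A \<inter> coord_image l om t B = {}"
proof (rule ccontr)
  assume "coord_image l om t A \<inter> coord_image l om t B \<noteq> {}"
  then obtain C C' R R' where C: "C \<in> A" "R \<in> C" "no_triple_points R" "comb_type l R = t"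
    and C': "C' \<in> B" "R' \<in> C'" "no_triple_points R'" "comb_type l R' = t"
    and eq: "arc_coords l om R = arc_coords l om R'"
    unfolding coord_image_def by blast
  have q: "C \<in> {R. circle_cactus k l R} // cactus_iso k l" "C' \<in> {R. circle_cactus k l R} // cactus_iso k l"
    using C(1) C'(1) assms(1,2) unfolding cactus_space_def by auto
  have "circle_cactus k l R" "circle_cactus k l R'"
    using C C' assms(1,2) Union_cactus_space[of k l] by blast+
  then have "(R, R') \<in> cactus_iso k l" using C C' eq by (intro arc_coords_inj) auto
  then have "C = C'" using quotient_eqI[OF equiv_cactus_iso q C(2) C'(2)] by simp
  with C(1) C'(1) assms(3) show False by auto
qed

lemma coord_image_UN: "coord_image l om t (\<Union>n. A n) = (\<Union>n. coord_image l om t (A n))"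
  unfolding coord_image_def by blast

lemma coord_image_Diff:
  assumes "A \<subseteq> cactus_space k l"
  shows "coord_image l om t (cactus_space k l - A) = coord_image l om t (cactus_space k l) - coord_image l om t A"
proof -
  have "coord_image l om t (cactus_space k l) = coord_image l om t (cactus_space k l - A) \<union> coord_image l om t A"
    using assms unfolding coord_image_def by blast
  moreover have "coord_image l om t (cactus_space k l - A) \<inter> coord_image l om t A = {}"
    using assms by (intro cactus_space_disjoint) auto
  ultimately show ?thesis by blast
qed

lemma generic_coord_arcs:
  assumes "E \<in> tree_edges {1..k} 1" "f \<in> orders k E"
  defines "t \<equiv> cyclic_type k E f"
  shows "t \<in> generic_types k l" "finite (coord_arcs om t)" "coord_arcs om t \<subseteq> {1..k} \<times> UNIV"
    "\<And>i. i \<in> {1..k} \<Longrightarrow> card (coord_arcs om t `` {i}) = card (E `` {i}) - 1"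
proof -
  show t: "t \<in> generic_types k l" unfolding generic_types_cyclic using assms by auto
  have arcs: "type_arcs t = E" unfolding t_def by (rule type_arcs_cyclic_type[OF k assms(1,2)])
  have E: "E \<subseteq> {1..k} \<times> {1..k}" using tree_edges_basic(1)[OF assms(1)] k by simp
  then have fin: "finite E" by (auto intro: finite_subset)
  show "finite (coord_arcs om t)" unfolding coord_arcs_def arcs using fin by (auto intro: finite_subset[of _ E])
  show "coord_arcs om t \<subseteq> {1..k} \<times> UNIV" unfolding coord_arcs_def arcs using E by auto
  fix i assume i: "i \<in> {1..k}"
  have "coord_arcs om t `` {i} = E `` {i} - {om t i}" unfolding coord_arcs_def arcs by auto
  moreover have "om t i \<in> E `` {i}" using om_nbr[OF t i] arcs by auto
  ultimately show "card (coord_arcs om t `` {i}) = card (E `` {i}) - 1" by simp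
qed

section \<open>Countable additivity and the total volume\<close>

abbreviation "events \<equiv> {A. A \<subseteq> cactus_space k l \<and>
         (\<forall>t\<in>generic_types k l. coord_image l om t A \<in> sets (coord_measure om t))}"

abbreviation "vol \<equiv> \<lambda>A. \<Sum>t\<in>generic_types k l. emeasure (coord_measure om t) (coord_image l om t A)"

lemma generic_typeE:
  assumes "t \<in> generic_types k l"
  obtains E f where "E \<in> tree_edges {1..k} 1" "f \<in> orders k E" "t = cyclic_type k E f"
  using assms unfolding generic_types_cyclic by auto

lemma space_in_events: "cactus_space k l \<in> events"
proof -
  have "coord_image l om t (cactus_space k l) \<in> sets (coord_measure om t)" if t: "t \<in> generic_types k l" for t
  proof -
    obtain E f where E: "E \<in> tree_edges {1..k} 1" "f \<in> orders k E" "t = cyclic_type k E f"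
      using generic_typeE[OF t] by blast
    show ?thesis
      unfolding coord_image_space[OF t] coord_measure_def
      by (rule sets_arc_simplices) (use generic_coord_arcs(2)[OF E(1,2)] E(3) in auto)
  qed
  then show ?thesis by simp
qed

lemma sigma_algebra_events: "sigma_algebra (cactus_space k l) events"
  unfolding sigma_algebra_iff2
proof (intro conjI ballI allI impI)
  show "events \<subseteq> Pow (cactus_space k l)" by auto
  show "{} \<in> events" by (auto simp: coord_image_def)
  show "cactus_space k l - A \<in> events" if "A \<in> events" for A
    using that space_in_events by (auto simp: coord_image_Diff)
  show "(\<Union>n. A n) \<in> events" if "range A \<subseteq> events" for A :: "nat \<Rightarrow> gluing set set"
    using that by (auto simp: coord_image_UN)
qed

lemma vol_countably_additive: "countably_additive events vol"
proof (rule countably_additiveI)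
  fix A :: "nat \<Rightarrow> gluing set set"
  assume A: "range A \<subseteq> events" "disjoint_family A"
  have "(\<Sum>n. vol (A n)) = (\<Sum>t\<in>generic_types k l. \<Sum>n. emeasure (coord_measure om t) (coord_image l om t (A n)))"
    by (rule suminf_sum) simp
  also have "\<dots> = (\<Sum>t\<in>generic_types k l. emeasure (coord_measure om t) (\<Union>n. coord_image l om t (A n)))"
  proof (intro sum.cong refl suminf_emeasure)
    fix t assume "t \<in> generic_types k l"
    then show "range (\<lambda>n. coord_image l om t (A n)) \<subseteq> sets (coord_measure om t)" using A(1) by auto
    show "disjoint_family (\<lambda>n. coord_image l om t (A n))"
      using A unfolding disjoint_family_on_def by (intro ballI impI cactus_space_disjoint) auto
  qed
  also have "\<dots> = vol (\<Union>n. A n)" by (simp add: coord_image_UN)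
  finally show "(\<Sum>n. vol (A n)) = vol (\<Union>n. A n)" .
qed

text \<open>\<open>measure_of\<close> falls back to zero unless its data form a measure space, so
  the value in the definition is attained only by virtue of the sigma-algebra and additivity
  proofs.\<close>

lemma emeasure_cactus_volume: "emeasure (cactus_volume k l om) (cactus_space k l) = vol (cactus_space k l)"
  unfolding cactus_volume_def
  by (rule emeasure_measure_of_sigma[OF sigma_algebra_events _ vol_countably_additive space_in_events])
    (simp add: positive_def coord_image_def)

text \<open>The volume \<open>?v E\<close> of a component depends only on the degrees of the tree,
  not on the cyclic orders or on \<open>om\<close>. Summing over the orders thus multiplies it by
  their number, which cancels the factorials.\<close>

lemma vol_cactus_space: "vol (cactus_space k l) = ennreal ((\<Sum>i=1..k. l i) ^ (k - 2))"
proof -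
  let ?T = "tree_edges {1..k} (1::nat)"
  let ?d = "\<lambda>E i. card (E `` {i}) - 1"
  let ?v = "\<lambda>E. \<Prod>i\<in>{1..k}. l i ^ ?d E i / fact (?d E i)"
  have v_nonneg: "0 \<le> ?v E" for E :: "(nat \<times> nat) set"
    using lpos by (intro prod_nonneg) (auto intro: less_imp_le)
  have "vol (cactus_space k l) = (\<Sum>(E, f)\<in>(SIGMA E:?T. orders k E).
      emeasure (coord_measure om (cyclic_type k E f)) (coord_image l om (cyclic_type k E f) (cactus_space k l)))"
    unfolding generic_types_cyclic by (subst sum.reindex[OF cyclic_type_inj[OF k]]) (simp add: split_def)
  also have "\<dots> = (\<Sum>(E, f)\<in>(SIGMA E:?T. orders k E). ennreal (?v E))"
  proof (rule sum.cong[OF refl], clarify)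
    fix E f assume E: "E \<in> ?T" "f \<in> orders k E"
    let ?t = "cyclic_type k E f"
    note gen = generic_coord_arcs[OF E]
    have "emeasure (coord_measure om ?t) (coord_image l om ?t (cactus_space k l))
       = ennreal (\<Prod>i\<in>{1..k}. l i ^ card (coord_arcs om ?t `` {i}) / fact (card (coord_arcs om ?t `` {i})))"
      unfolding coord_image_space[OF gen(1)] coord_measure_def
      by (rule emeasure_arc_simplices) (use gen lpos in auto)
    also have "\<dots> = ennreal (?v E)"
      by (intro arg_cong[where f = ennreal] prod.cong refl) (simp add: gen(4))
    finally show "emeasure (coord_measure om ?t) (coord_image l om ?t (cactus_space k l)) = ennreal (?v E)" .
  qed
  also have "\<dots> = (\<Sum>E\<in>?T. \<Sum>f\<in>orders k E. ennreal (?v E))"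
    by (rule sum.Sigma[symmetric]) (auto intro: finite_tree_edges finite_orders)
  also have "\<dots> = ennreal (\<Sum>E\<in>?T. \<Sum>f\<in>orders k E. ?v E)"
    by (simp only: sum_ennreal v_nonneg sum_nonneg)
  also have "(\<Sum>E\<in>?T. \<Sum>f\<in>orders k E. ?v E) = (\<Sum>E\<in>?T. \<Prod>i\<in>{1..k}. l i ^ ?d E i)"
  proof (rule sum.cong[OF refl])
    fix E assume E: "E \<in> ?T"
    have "(\<Sum>f\<in>orders k E. ?v E) = (\<Prod>i\<in>{1..k}. fact (?d E i)) * ?v E"
      by (simp add: card_orders[OF k E])
    also have "\<dots> = (\<Prod>i\<in>{1..k}. l i ^ ?d E i)"
      unfolding prod.distrib[symmetric] by (intro prod.cong) auto
    finally show "(\<Sum>f\<in>orders k E. ?v E) = (\<Prod>i\<in>{1..k}. l i ^ ?d E i)" .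
  qed
  also have "\<dots> = (\<Sum>i=1..k. l i) ^ (card {1..k} - 2)"
    by (rule weighted_cayley) (use k lpos[of 1] in auto)
  finally show ?thesis by simp
qed

end

theorem theorem2:
  fixes k :: nat and l :: "nat \<Rightarrow> real" and om :: "comb_type \<Rightarrow> nat \<Rightarrow> nat"
  assumes "k \<ge> 2"
    and "\<And>i. i \<in> {1..k} \<Longrightarrow> l i > 0"
    and "arc_omission k l om"
  shows "emeasure (cactus_volume k l om) (cactus_space k l) =
    ennreal ((\<Sum>i=1..k. l i) ^ (k - 2))"
  using emeasure_cactus_volume[OF assms] vol_cactus_space[OF assms] by simp

end
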